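(* Let $M\ge 0$ be a fixed integer and let the positions $X_1,\dots,X_M$ of the interferers be independent and uniformly distributed over the disk $\mathcal A$ of radius $r_{\mathsf{out}}$ centered at the origin, with common access probability $p_i=p\in[0,1]$ for all $i$. Then the spatially averaged joint first moment of the conditional outage probabilities at the two receivers is $$\mathbb E_{\boldsymbol r}[\epsilon_1(\boldsymbol r)\,\epsilon_2(\boldsymbol r)\mid M]=2\,\mathbb E_{\boldsymbol r}[\epsilon_j(\boldsymbol r)\mid M]-1+\exp\left(-\frac{2\beta}{\mathsf{SNR}}\right)\mathcal W(r_{\mathsf{out}},r_0,\theta)^M$$ (for either $j\in\{1,2\}$), where $$\mathcal W(r_{\mathsf{out}},r_0,\theta)=(1-p)^2+p^2\mathcal X(\theta)+\frac{4r_0^2}{|\mathcal A|}(1-p)p\left[\frac{\pi}{\beta}\Psi\left(\frac{r_{\mathsf{out}}-r_0}{r_0}\right)+\mathcal Z_1(r_{\mathsf{out}},r_0)\right],$$ $$\mathcal X(\theta)=\frac1{2\pi}\int_0^1\int_0^{2\pi}\frac{r^\alpha(\rho,\phi,0)}{\beta+r^\alpha(\rho,\phi,0)}\cdot\frac{r^\alpha(\rho,\phi,\theta)}{\beta+r^\alpha(\rho,\phi,\theta)}\,d\phi\,d\rho,\qquad r(\rho,\phi,\theta)=\frac{\left|r_0e^{\mathrm{i}\theta}+r_{\mathsf{out}}\sqrt{\rho}\,e^{\mathrm{i}\phi}\right|}{r_0},$$ $$\Psi(x)=\int_0^x\frac{r^{\alpha+1}}{1+r^\alpha\beta^{-1}}\,dr=\frac{x^{\alpha+2}}{2+\alpha}\;{}_2F_1\left(1,\tfrac{2}{\alpha}+1;\tfrac{2}{\alpha}+2;-\tfrac{x^\alpha}{\beta}\right),$$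 $$\mathcal Z_1(x,y)=\int_{(x-y)/y}^{(x+y)/y}\frac{r^{\alpha+1}}{\beta+r^\alpha}\arccos\left(\frac{y^2r^2+y^2-x^2}{2y^2r}\right)dr .$$
   Context: Network model. Identify the plane with $\mathbb C$. The network region $\mathcal A$ is the disk of radius $r_{\mathsf{out}}$ centered at $0$, with area $|\mathcal A|=\pi r_{\mathsf{out}}^2$. A reference transmitter is at $X_0=0$; two receivers are at $Y_1=r_0$ and $Y_2=r_0e^{\mathrm{i}\theta}$, where $0<r_0\le r_{\mathsf{out}}$, $\theta\in\mathbb R$. There are $M$ interferers at positions $X_1,\dots,X_M\in\mathcal A$. Put $r_{i,j}=|X_i-Y_j|/r_0$ (normalized distance) and $\boldsymbol r=\{r_{i,j}\}_{1\le i\le M,\,j\in\{1,2\}}$. Constants: path-loss exponent $\alpha>0$, SINR threshold $\beta>0$, $\mathsf{SNR}>0$. The SINR at $Y_j$ is $$\gamma_j=\frac{g_{0,j}}{\mathsf{SNR}^{-1}+\sum_{i=1}^M I_i\,g_{i,j}\,r_{i,j}^{-\alpha}},$$ where the $g_{i,j}$ are i.i.d. unit-mean exponential random variables (Rayleigh fading), the $I_i$ are independent Bernoulli variables with $\mathbb P[I_i=1]=p_i$, and the $g$'s, the $I$'s and the positions are mutually independent. The conditional outage probability is $$\epsilon_j(\boldsymbol r)=\mathbb P[\gamma_j\le\beta\mid\boldsymbol r,M]=1-\exp\left(-\frac{\beta}{\mathsf{SNR}}\right)\prod_{i=1}^M\left(1-p_i+\frac{p_i\,r_{i,j}^\alpha}{\beta+r_{i,j}^\alpha}\right).$$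 $\mathbb E_{\boldsymbol r}[\,\cdot\mid M]$ denotes expectation over the interferer positions for the given number $M$; by rotational symmetry $\mathbb E_{\boldsymbol r}[\epsilon_j(\boldsymbol r)\mid M]$ does not depend on $j$. ${}_2F_1$ is the Gauss hypergeometric function. *)

theory Defs
  imports "HOL-Probability.Probability" "HOL-Complex_Analysis.Complex_Analysis"
begin

(* The principal branch: the analytic continuation of the hypergeometric series to the plane
   slit along [1, \<infinity>).  That domain is connected, so the continuation F is unique;
   the value is meaningful only for z off the slit and when F exists. *)
definition gauss_2F1 :: "complex \<Rightarrow> complex \<Rightarrow> complex \<Rightarrow> complex \<Rightarrow> complex" where
  "gauss_2F1 a b c z =
     (THE w. \<exists>F. F holomorphic_on (- complex_of_real ` {1..}) \<and>
                 F has_fps_expansion fps_hypergeo [a, b] [c] 1 \<and> w = F z)"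

definition region :: "real \<Rightarrow> complex set" where
  "region r_out = cball 0 r_out"

definition receiver :: "real \<Rightarrow> real \<Rightarrow> nat \<Rightarrow> complex" where
  "receiver r0 \<theta> j = (if j = 1 then of_real r0 else of_real r0 * exp (\<i> * of_real \<theta>))"

definition ndist :: "real \<Rightarrow> real \<Rightarrow> (nat \<Rightarrow> complex) \<Rightarrow> nat \<Rightarrow> nat \<Rightarrow> real" where
  "ndist r0 \<theta> x i j = cmod (x i - receiver r0 \<theta> j) / r0"

(* Since 0 powr (-\<alpha>) = 0, an interferer located exactly at a receiver contributes nothing;
   this happens with probability 0 for the position distributions considered. *)
definition sinr ::
  "real \<Rightarrow> real \<Rightarrow> nat \<Rightarrow> (nat \<Rightarrow> nat \<Rightarrow> real) \<Rightarrow> (nat \<Rightarrow> bool) \<Rightarrow> (nat \<Rightarrow> nat \<Rightarrow> real) \<Rightarrow> nat \<Rightarrow> real" where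
  "sinr \<alpha> SNR M g I r j =
     g 0 j / (inverse SNR + (\<Sum>i=1..M. of_bool (I i) * g i j * r i j powr (-\<alpha>)))"

definition dist_algebra ::
  "'w measure \<Rightarrow> real \<Rightarrow> real \<Rightarrow> nat \<Rightarrow> (nat \<Rightarrow> 'w \<Rightarrow> complex) \<Rightarrow> 'w measure" where
  "dist_algebra \<Omega> r0 \<theta> M X =
     vimage_algebra (space \<Omega>)
       (\<lambda>\<omega>. \<lambda>(i, j)\<in>{1..M} \<times> {1, 2}. ndist r0 \<theta> (\<lambda>i. X i \<omega>) i j)
       (Pi\<^sub>M ({1..M} \<times> {1, 2}) (\<lambda>_. borel))"

(* A version of P[\<gamma>_j \<le> \<beta> | r], as a random variable measurable with respect to \<sigma>(r). *)
definition cond_outage ::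
  "'w measure \<Rightarrow> real \<Rightarrow> real \<Rightarrow> real \<Rightarrow> real \<Rightarrow> real \<Rightarrow> nat \<Rightarrow>
   (nat \<Rightarrow> nat \<Rightarrow> 'w \<Rightarrow> real) \<Rightarrow> (nat \<Rightarrow> 'w \<Rightarrow> bool) \<Rightarrow> (nat \<Rightarrow> 'w \<Rightarrow> complex) \<Rightarrow> nat \<Rightarrow> 'w \<Rightarrow> real" where
  "cond_outage \<Omega> \<alpha> \<beta> SNR r0 \<theta> M g I X j =
     real_cond_exp \<Omega> (dist_algebra \<Omega> r0 \<theta> M X)
       (indicator {\<omega> \<in> space \<Omega>.
          sinr \<alpha> SNR M (\<lambda>i j. g i j \<omega>) (\<lambda>i. I i \<omega>) (ndist r0 \<theta> (\<lambda>i. X i \<omega>)) j \<le> \<beta>})"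

(* indep_vars requires a common codomain, so independence of the real, boolean and complex
   random variables is expressed through the \<sigma>-algebras they generate. *)
datatype source = Fading nat nat | Access nat | Position nat

definition sources :: "nat \<Rightarrow> source set" where
  "sources M = {Fading i j | i j. i \<in> {0..M} \<and> j \<in> {1, 2}} \<union>
               {Access i | i. i \<in> {1..M}} \<union> {Position i | i. i \<in> {1..M}}"

definition source_events ::
  "'w measure \<Rightarrow> (nat \<Rightarrow> nat \<Rightarrow> 'w \<Rightarrow> real) \<Rightarrow> (nat \<Rightarrow> 'w \<Rightarrow> bool) \<Rightarrow> (nat \<Rightarrow> 'w \<Rightarrow> complex) \<Rightarrow>
   source \<Rightarrow> 'w set set" where
  "source_events \<Omega> g I X s =
     (case s of
        Fading i j \<Rightarrow> sets (vimage_algebra (space \<Omega>) (g i j) borel)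
      | Access i \<Rightarrow> sets (vimage_algebra (space \<Omega>) (I i) (count_space UNIV))
      | Position i \<Rightarrow> sets (vimage_algebra (space \<Omega>) (X i) borel))"

definition rpolar :: "real \<Rightarrow> real \<Rightarrow> real \<Rightarrow> real \<Rightarrow> real \<Rightarrow> real" where
  "rpolar r_out r0 \<rho> \<phi> \<theta> =
     cmod (of_real r0 * exp (\<i> * of_real \<theta>) + of_real (r_out * sqrt \<rho>) * exp (\<i> * of_real \<phi>)) / r0"

definition calX :: "real \<Rightarrow> real \<Rightarrow> real \<Rightarrow> real \<Rightarrow> real \<Rightarrow> real" where
  "calX \<alpha> \<beta> r_out r0 \<theta> = 1 / (2 * pi) *
     (LINT \<rho>:{0..1}|lborel. LINT \<phi>:{0..2 * pi}|lborel.
        rpolar r_out r0 \<rho> \<phi> 0 powr \<alpha> / (\<beta> + rpolar r_out r0 \<rho> \<phi> 0 powr \<alpha>) *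
        (rpolar r_out r0 \<rho> \<phi> \<theta> powr \<alpha> / (\<beta> + rpolar r_out r0 \<rho> \<phi> \<theta> powr \<alpha>)))"

definition Psi :: "real \<Rightarrow> real \<Rightarrow> real \<Rightarrow> real" where
  "Psi \<alpha> \<beta> x = (LINT r:{0..x}|lborel. r powr (\<alpha> + 1) / (1 + r powr \<alpha> * inverse \<beta>))"

definition calZ1 :: "real \<Rightarrow> real \<Rightarrow> real \<Rightarrow> real \<Rightarrow> real" where
  "calZ1 \<alpha> \<beta> x y =
     (LINT r:{(x - y) / y..(x + y) / y}|lborel.
        r powr (\<alpha> + 1) / (\<beta> + r powr \<alpha>) *
        arccos ((y\<^sup>2 * r\<^sup>2 + y\<^sup>2 - x\<^sup>2) / (2 * y\<^sup>2 * r)))"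

definition calW :: "real \<Rightarrow> real \<Rightarrow> real \<Rightarrow> real \<Rightarrow> real \<Rightarrow> real \<Rightarrow> real" where
  "calW \<alpha> \<beta> p r_out r0 \<theta> =
     (1 - p)\<^sup>2 + p\<^sup>2 * calX \<alpha> \<beta> r_out r0 \<theta> +
     4 * r0\<^sup>2 / measure lborel (region r_out) * (1 - p) * p *
       (pi / \<beta> * Psi \<alpha> \<beta> ((r_out - r0) / r0) + calZ1 \<alpha> \<beta> r_out r0)"

end

theory Submission
  imports Defs
begin

text \<open>Given the positions, a threshold crossing of the unit exponential \<open>g 0 j\<close> has probability
  \<open>exp (- \<beta> (1/SNR + interference))\<close>, and the Laplace transform of the interference factors over
  the interferers; this gives the conditional outage probability as one minus a product.  The
  product of the two success probabilities is again a product of independent identically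
  distributed factors, one per interferer.  The mixed terms of such a factor
  are averages of a function of \<open>\<bar>z - Y\<^sub>j\<bar>\<close> over the disk: in polar coordinates around
  \<open>Y\<^sub>j\<close>, a circle of small radius lies inside the disk (the \<open>\<Psi>\<close> term) and a larger one
  meets it in an arc of length \<open>2 arccos\<close> (the \<open>Z\<^sub>1\<close> term).  The hypergeometric form of
  \<open>\<Psi>\<close> is Euler's integral after the substitution \<open>t = (r/x) powr \<alpha>\<close>.\<close>

section \<open>Euler's integral for the hypergeometric function\<close>

text \<open>\<open>gauss_2F1\<close> is specified by analytic continuation. Euler's integral must
  therefore be holomorphic on the whole slit plane, match the hypergeometric series near 0, and be
  unique by connectedness, before it can be evaluated at the negative argument that
  \<open>Psi\<close> needs. The moment is that of a product of conditional probabilities, not the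
  probability of a joint outage: fading and access are averaged out for each receiver separately,
  and only the common positions couple the two. With s_j the conditional success probability, (1 -
  s_1)(1 - s_2) = 1 - s_1 - s_2 + s_1 s_2, and E s_1 = E s_2 by rotational symmetry; this is where
  twice the mean outage minus one comes from. \<open>calW\<close> is the mean of (1 - p + p a_1)(1 -
  p + p a_2) for one interferer. Its two mixed terms have equal means, each with the constant 2 r0^2
  / |A|; hence the 4. Integrals stay nonnegative (\<open>ennreal\<close>) as long as possible, so
  that Fubini and substitution need only measurability. Conditional expectations, positivity of the
  fading and of the distances are controlled only almost everywhere, and so are most
  identities.\<close>

lemma one_minus_mult_neq_0_slit:
  fixes z :: complex
  assumes "z \<in> - complex_of_real ` {1..}" and "0 \<le> t" and "t \<le> 1"
  shows "1 - z * of_real t \<noteq> 0"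
proof
  assume eq: "1 - z * of_real t = 0"
  then have "t \<noteq> 0" by auto
  with eq have "z = of_real (1 / t)" by (simp add: field_simps)
  moreover have "1 \<le> 1 / t" using assms \<open>t \<noteq> 0\<close> by simp
  ultimately show False using assms(1) by (metis ComplD atLeast_iff image_eqI)
qed

lemma open_slit_plane: "open (- complex_of_real ` {1..})"
proof -
  have "complex_of_real ` {1..} = \<real> \<inter> {z. Re z \<ge> 1}"
    by (auto elim!: Reals_cases)
  then have "closed (complex_of_real ` {1..})"
    by (simp only: closed_Int closed_complex_Reals closed_halfspace_Re_ge)
  then show ?thesis by (rule open_Compl)
qed

text \<open>The domain is star-shaped about 0: if the segment from 0 to z met the slit at s, then z
  = s / u with 0 < u \<le> 1 would itself lie on the slit. Connectedness is what makes the analytic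
  continuation unique.\<close>

lemma connected_slit_plane: "connected (- complex_of_real ` {1..})"
proof -
  have "starlike (- complex_of_real ` {1..})"
    unfolding starlike_def
  proof (intro bexI ballI subsetI)
    fix z w :: complex
    assume z: "z \<in> - complex_of_real ` {1..}" and w: "w \<in> closed_segment 0 z"
    then obtain u where u: "0 \<le> u" "u \<le> 1" "w = of_real u * z"
      by (auto simp: closed_segment_def scaleR_conv_of_real)
    have "w \<notin> complex_of_real ` {1..}"
    proof
      assume "w \<in> complex_of_real ` {1..}"
      then obtain s where s: "w = of_real s" "s \<ge> 1" by auto
      then have "u \<noteq> 0" using u by auto
      moreover have "1 - z * of_real (u / s) = 0"
        using s u by (simp add: field_simps)
      moreover have "0 \<le> u / s" "u / s \<le> 1" using s u by (auto simp: field_simps)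
      ultimately show False using one_minus_mult_neq_0_slit[OF z] by blast
    qed
    then show "w \<in> - complex_of_real ` {1..}" by simp
  qed auto
  then show ?thesis by (rule starlike_imp_connected)
qed

text \<open>Euler's integral for 2F1(1, a; a + 1; z). For these parameters the Gamma prefactor
  reduces to a, and the factor (1 - t)^(c - b - 1) has exponent 0.\<close>

definition euler_2F1 :: "real \<Rightarrow> complex \<Rightarrow> complex" where
  "euler_2F1 a z =
     integral (cbox 0 1) (\<lambda>t. of_real (a * t powr (a - 1)) / (1 - z * of_real t))"

lemma continuous_on_euler_kernel:
  assumes "a > 1" and "z \<in> - complex_of_real ` {1..}"
  shows "continuous_on (cbox 0 1)
           (\<lambda>t. complex_of_real (a * t powr (a - 1)) / (1 - z * of_real t))"
proof -
  have "1 - z * of_real t \<noteq> 0" if "t \<in> cbox 0 1" for t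
    using one_minus_mult_neq_0_slit[OF assms(2)] that by simp
  then show ?thesis
    using assms(1) by (intro continuous_on_powr' continuous_intros) auto
qed

text \<open>Differentiation under the integral sign. The Leibniz rule asks for a convex domain and
  the slit plane is not convex, so it is applied on a small ball around each point.\<close>

lemma holomorphic_euler_2F1:
  assumes a: "a > 1"
  shows "euler_2F1 a holomorphic_on (- complex_of_real ` {1..})"
proof -
  let ?D = "- complex_of_real ` {1..}"
  have "euler_2F1 a field_differentiable at z" if z: "z \<in> ?D" for z
  proof -
    obtain e where e: "e > 0" "ball z e \<subseteq> ?D"
      using open_slit_plane z by (meson open_contains_ball)
    have nz: "1 - w * of_real t \<noteq> 0" if "w \<in> ball z e" "t \<in> cbox 0 1" for w t
      using one_minus_mult_neq_0_slit[of w t] e that by auto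
    have "euler_2F1 a holomorphic_on ball z e"
      unfolding euler_2F1_def
    proof (rule leibniz_rule_holomorphic[where
          fx = "\<lambda>w t. of_real (a * t powr (a - 1)) * of_real t / (1 - w * of_real t)\<^sup>2"])
      show "((\<lambda>w. of_real (a * t powr (a - 1)) / (1 - w * of_real t)) has_field_derivative
              of_real (a * t powr (a - 1)) * of_real t / (1 - w * of_real t)\<^sup>2) (at w within ball z e)"
        if "w \<in> ball z e" "t \<in> cbox 0 1" for w t
        using nz[OF that]
        by (auto intro!: derivative_eq_intros simp: power2_eq_square)
      show "(\<lambda>t. of_real (a * t powr (a - 1)) / (1 - w * of_real t)) integrable_on cbox 0 1"
        if "w \<in> ball z e" for w
        using e that by (intro integrable_continuous continuous_on_euler_kernel a) auto
      show "continuous_on (ball z e \<times> cbox 0 1)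
              (\<lambda>(w, t). complex_of_real (a * t powr (a - 1)) * of_real t / (1 - w * of_real t)\<^sup>2)"
        unfolding case_prod_beta using nz a
        by (intro continuous_on_powr' continuous_intros) (auto simp: mem_Times_iff)
    qed simp
    with e show ?thesis
      using holomorphic_on_imp_differentiable_at[of _ "ball z e" z] by auto
  qed
  then show ?thesis
    by (auto simp: holomorphic_on_def intro: field_differentiable_at_within)
qed

text \<open>The geometric series of 1 / (1 - z t) converges uniformly in t \<in> [0, 1] because |z|
  < 1, so it may be integrated term by term; the n-th term contributes a / (a + n).\<close>

lemma euler_2F1_sums:
  assumes a: "a > 1" and z: "norm z < 1"
  shows "(\<lambda>n. of_real (a / (a + real n)) * z ^ n) sums euler_2F1 a z"
proof -
  let ?k = "\<lambda>n t. complex_of_real (a * t powr (a - 1)) * (z * of_real t) ^ n"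
  have zt: "norm (z * of_real t) < 1" if "t \<in> cbox 0 1" for t
  proof -
    have "norm (z * of_real t) \<le> norm z * 1"
      unfolding norm_mult using that by (intro mult_left_mono) auto
    with z show ?thesis by simp
  qed
  have lim: "uniform_limit (cbox 0 1) (\<lambda>n t. \<Sum>i<n. ?k i t)
          (\<lambda>t. \<Sum>i. ?k i t) sequentially"
  proof (rule Weierstrass_m_test[where M = "\<lambda>n. a * norm z ^ n"])
    show "norm (?k n t) \<le> a * norm z ^ n" if "t \<in> cbox 0 1" for n t
    proof -
      have "a * t powr (a - 1) \<le> a * 1"
        using that a by (intro mult_left_mono powr_le1) auto
      moreover have "norm (z * of_real t) ^ n \<le> norm z ^ n"
        using that by (intro power_mono) (auto simp: norm_mult mult_left_le)
      ultimately show ?thesis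
        using a unfolding norm_mult norm_power norm_of_real by (intro mult_mono) auto
    qed
    show "summable (\<lambda>n. a * norm z ^ n)"
      using z by (intro summable_mult summable_geometric) auto
  qed
  have suminf: "(\<Sum>i. ?k i t) = of_real (a * t powr (a - 1)) / (1 - z * of_real t)"
    if "t \<in> cbox 0 1" for t
    using zt[OF that] suminf_mult[OF summable_geometric[OF zt[OF that]]]
    by (simp add: suminf_geometric)
  have cont: "continuous_on (cbox 0 1) (\<lambda>t. \<Sum>i<n. ?k i t)" for n
    using a by (intro continuous_on_powr' continuous_intros) auto
  obtain I J where IJ: "\<And>n. ((\<lambda>t. \<Sum>i<n. ?k i t) has_integral I n) (cbox 0 1)"
     "((\<lambda>t. \<Sum>i. ?k i t) has_integral J) (cbox 0 1)" "I \<longlonglongrightarrow> J"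
    by (rule uniform_limit_integral_cbox[OF lim cont]) auto
  have "((\<lambda>t. \<Sum>i<n. ?k i t) has_integral (\<Sum>i<n. of_real (a / (a + real i)) * z ^ i)) (cbox 0 1)" for n
  proof (intro has_integral_sum)
    fix i
    have "((\<lambda>t. t powr (a - 1 + real i)) has_integral (1 powr (a - 1 + real i + 1) / (a - 1 + real i + 1))) {0..1}"
      using a by (intro has_integral_powr_from_0) auto
    then have "((\<lambda>t. t powr (a - 1 + real i)) has_integral (1 / (a + real i))) (cbox 0 1)"
      by (simp add: add_ac)
    then have "((\<lambda>t. complex_of_real (t powr (a - 1 + real i))) has_integral of_real (1 / (a + real i))) (cbox 0 1)"
      by (rule has_integral_of_real)
    then have "((\<lambda>t. of_real a * z ^ i * complex_of_real (t powr (a - 1 + real i))) has_integral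
                 of_real a * z ^ i * of_real (1 / (a + real i))) (cbox 0 1)"
      by (rule has_integral_mult_right)
    moreover have "of_real a * z ^ i * complex_of_real (t powr (a - 1 + real i)) = ?k i t" if "t \<in> cbox 0 1" for t
    proof (cases "t = 0")
      case False
      then show ?thesis using that
        by (simp add: powr_add powr_realpow power_mult_distrib mult_ac)
    qed (use a in auto)
    ultimately show "(?k i has_integral of_real (a / (a + real i)) * z ^ i) (cbox 0 1)"
      by (subst has_integral_cong[symmetric, rotated]) (auto simp: field_simps)
  qed simp
  then have "I = (\<lambda>n. \<Sum>i<n. of_real (a / (a + real i)) * z ^ i)"
    using IJ(1) has_integral_unique by blast
  moreover have "J = euler_2F1 a z"
    unfolding euler_2F1_def using IJ(2) integral_unique suminf
    by (metis (no_types, lifting) integral_cong)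
  ultimately show ?thesis
    using IJ(3) by (simp only: sums_def)
qed

text \<open>Both \<open>a * pochhammer (a + 1) n\<close> and
  \<open>pochhammer a n * (a + of_nat n)\<close> equal \<open>pochhammer a (Suc n)\<close>;
  excluding nonpositive integers keeps the denominators nonzero.\<close>

lemma pochhammer_Suc_ratio:
  fixes a :: complex
  assumes "a \<notin> \<int>\<^sub>\<le>\<^sub>0"
  shows "pochhammer a n / pochhammer (a + 1) n = a / (a + of_nat n)"
proof -
  have "pochhammer (a + 1) n \<noteq> 0"
    using assms by (auto simp: pochhammer_eq_0_iff) 
      (metis add_diff_cancel_right' diff_minus_eq_add minus_add_distrib minus_of_nat_in_nonpos_Ints of_nat_Suc add.commute uminus_add_conv_diff)
  moreover have "a + of_nat n \<noteq> 0"
    using assms by (metis add_eq_0_iff2 minus_of_nat_in_nonpos_Ints)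
  moreover have "a * pochhammer (a + 1) n = pochhammer a n * (a + of_nat n)"
    using pochhammer_rec[of a n] pochhammer_Suc[of a n] by simp
  ultimately show ?thesis by (simp add: field_simps)
qed

text \<open>The upper parameter 1 contributes n!, which cancels the factorial of the hypergeometric
  coefficient. What remains is the ratio of Pochhammer symbols that telescopes to a / (a +
  n).\<close>

lemma euler_2F1_has_fps_expansion:
  assumes a: "a > 1"
  shows "euler_2F1 a has_fps_expansion fps_hypergeo [1, of_real a] [of_real (a + 1)] 1"
proof (rule has_fps_expansionI)
  have nonpos: "complex_of_real a \<notin> \<int>\<^sub>\<le>\<^sub>0"
  proof
    assume "complex_of_real a \<in> \<int>\<^sub>\<le>\<^sub>0"
    then obtain k where "complex_of_real a = of_int k" "k \<le> 0" by (rule nonpos_Ints_cases)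
    then have "Re (complex_of_real a) = Re (of_int k)" by simp
    with a \<open>k \<le> 0\<close> show False by simp
  qed
  have coeff: "fps_hypergeo [1, complex_of_real a] [of_real (a + 1)] 1 $ n = of_real (a / (a + real n))" for n
    using pochhammer_Suc_ratio[OF nonpos, of n]
    by (simp add: pochhammer_fact[symmetric])
  have "eventually (\<lambda>u::complex. u \<in> ball 0 1) (nhds 0)"
    by (intro eventually_nhds_in_open) auto
  then show "eventually (\<lambda>u. (\<lambda>n. fps_hypergeo [1, complex_of_real a] [of_real (a + 1)] 1 $ n * u ^ n) sums
        euler_2F1 a u) (nhds 0)"
  proof eventually_elim
    case (elim u)
    then show ?case unfolding coeff using euler_2F1_sums[OF a, of u] by simp
  qed
qed

text \<open>Two continuations with the same expansion at 0 agree near 0, hence on the whole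
  connected slit plane. So the description in \<open>gauss_2F1\<close> is unique, and one witness
  determines its value.\<close>

lemma gauss_2F1_eqI:
  assumes F: "F holomorphic_on (- complex_of_real ` {1..})"
    and Fe: "F has_fps_expansion fps_hypergeo [a, b] [c] 1"
    and z: "z \<in> - complex_of_real ` {1..}"
  shows "gauss_2F1 a b c z = F z"
  unfolding gauss_2F1_def
proof (rule the_equality)
  show "\<exists>G. G holomorphic_on (- complex_of_real ` {1..}) \<and>
            G has_fps_expansion fps_hypergeo [a, b] [c] 1 \<and> F z = G z"
    using F Fe by blast
next
  fix w
  assume "\<exists>G. G holomorphic_on (- complex_of_real ` {1..}) \<and>
              G has_fps_expansion fps_hypergeo [a, b] [c] 1 \<and> w = G z"
  then obtain G where G: "G holomorphic_on (- complex_of_real ` {1..})"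
    "G has_fps_expansion fps_hypergeo [a, b] [c] 1" "w = G z" by blast
  have "eventually (\<lambda>u. F u = G u) (nhds 0)"
    using Fe G(2) unfolding has_fps_expansion_def
    by (auto elim: eventually_elim2)
  then obtain S where S: "open S" "0 \<in> S" "\<And>u. u \<in> S \<Longrightarrow> F u = G u"
    unfolding eventually_nhds by blast
  have "G z = F z"
  proof (rule analytic_continuation_open[of "S \<inter> - complex_of_real ` {1..}" "- complex_of_real ` {1..}" G F])
    show "S \<inter> - complex_of_real ` {1..} \<noteq> {}" using S(2) by auto
  qed (use S open_slit_plane connected_slit_plane F G z in auto)
  with G show "w = F z" by simp
qed

lemma gauss_2F1_euler:
  assumes "a > 1" and "z \<in> - complex_of_real ` {1..}"
  shows "gauss_2F1 1 (of_real a) (of_real (a + 1)) z = euler_2F1 a z"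
  using holomorphic_euler_2F1[OF assms(1)] euler_2F1_has_fps_expansion[OF assms(1)] assms(2)
  by (intro gauss_2F1_eqI) simp_all

lemma Psi_eq_gauss_2F1:
  assumes \<alpha>: "\<alpha> > 0" and \<beta>: "\<beta> > 0" and x: "x \<ge> 0"
  shows "complex_of_real (Psi \<alpha> \<beta> x) =
           of_real (x powr (\<alpha> + 2) / (2 + \<alpha>)) *
           gauss_2F1 1 (of_real (2 / \<alpha> + 1)) (of_real (2 / \<alpha> + 2)) (of_real (- (x powr \<alpha> / \<beta>)))"
\<comment> \<open>The substitution below divides by x. At x = 0 both sides are 0: the integral runs
  over one point and \<open>0 powr (\<alpha> + 2) = 0\<close>.\<close>
proof (cases "x = 0")
  case True
  then show ?thesis by (simp add: Psi_def set_lebesgue_integral_def indicator_def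
        integral_eq_zero_AE cong: if_cong)
next
  case False
  with x have x: "x > 0" by simp
  \<comment> \<open>With t = (r / x)^\<alpha> this exponent turns t^(a - 1) into (r / x)^2, and with
    the r^(\<alpha> - 1) of dt that gives the r^(\<alpha> + 1) of \<open>Psi\<close>. Since \<alpha>
    a = \<alpha> + 2, the prefactor comes out as well.\<close>
  define a where "a = 2 / \<alpha> + 1"
  define c where "c = x powr \<alpha> / \<beta>"
  have a: "a > 1" and c: "c > 0" using \<alpha> \<beta> x by (auto simp: a_def c_def)
  let ?f = "\<lambda>t. a * t powr (a - 1) / (1 + c * t)"
  let ?h = "\<lambda>r. r powr (\<alpha> + 1) / (1 + r powr \<alpha> * inverse \<beta>)"
  have pos: "1 + r powr \<alpha> * inverse \<beta> > 0" for r using \<beta> by (simp add: add_pos_nonneg)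
  have "((\<lambda>r. (\<alpha> * (r / x) powr (\<alpha> - 1) * (1 / x)) *\<^sub>R ?f ((r / x) powr \<alpha>)) has_integral
          (integral {(0 / x) powr \<alpha>..(x / x) powr \<alpha>} ?f)) {0..x}"
  \<comment> \<open>The point 0 is exempted from differentiability: for \<alpha> < 1 the map r
    \<mapsto> (r / x)^\<alpha> has infinite slope there.\<close>
  proof (rule has_integral_substitution_strong[where s = "{0}" and c = 0 and d = 1])
    show "(\<lambda>r. (r / x) powr \<alpha>) ` {0..x} \<subseteq> {0..1}"
      using x \<alpha> by (auto intro!: powr_le1 simp: field_simps)
    show "continuous_on {0..1} ?f"
      using a c by (intro continuous_on_powr' continuous_intros) (auto simp: add_nonneg_eq_0_iff)
    show "continuous_on {0..x} (\<lambda>r. (r / x) powr \<alpha>)"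
      using \<alpha> x by (intro continuous_on_powr' continuous_intros) auto
    show "((\<lambda>r. (r / x) powr \<alpha>) has_field_derivative \<alpha> * (r / x) powr (\<alpha> - 1) * (1 / x)) (at r within {0..x})"
      if "r \<in> {0..x} - {0}" for r
      using that x by (auto intro!: derivative_eq_intros simp: powr_diff)
  qed (use x \<alpha> in auto)
  moreover have "(\<alpha> * (r / x) powr (\<alpha> - 1) * (1 / x)) *\<^sub>R ?f ((r / x) powr \<alpha>)
      = (\<alpha> + 2) / x powr (\<alpha> + 2) * ?h r" if "r \<in> {0..x}" for r
  \<comment> \<open>At r = 0 both sides vanish by the convention that \<open>0 powr y = 0\<close>
    for every y, including negative y.\<close>
  proof (cases "r = 0")
    case False
    with that have r: "r > 0" by simp
    have 1: "((r / x) powr \<alpha>) powr (a - 1) = (r / x)\<^sup>2"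
      using r x \<alpha> by (simp add: powr_powr a_def powr_numeral)
    have 2: "c * (r / x) powr \<alpha> = r powr \<alpha> * inverse \<beta>"
      using r x by (simp add: c_def powr_divide field_simps)
    have 3: "\<alpha> * a = \<alpha> + 2" using \<alpha> by (simp add: a_def field_simps)
    have 4: "(r / x) powr (\<alpha> - 1) * (1 / x) * (r / x)\<^sup>2 = r powr (\<alpha> + 1) / x powr (\<alpha> + 2)"
      using r x by (simp add: powr_diff powr_add powr_divide field_simps power2_eq_square)
    have "(\<alpha> * (r / x) powr (\<alpha> - 1) * (1 / x)) *\<^sub>R ?f ((r / x) powr \<alpha>) =
        (\<alpha> * a) * ((r / x) powr (\<alpha> - 1) * (1 / x) * (r / x)\<^sup>2) / (1 + r powr \<alpha> * inverse \<beta>)"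
      unfolding 1 2 by simp
    also have "\<dots> = (\<alpha> + 2) / x powr (\<alpha> + 2) * ?h r"
      unfolding 3 4 by simp
    finally show ?thesis .
  qed (use \<alpha> a in simp)
  ultimately have "((\<lambda>r. (\<alpha> + 2) / x powr (\<alpha> + 2) * ?h r) has_integral integral {0..1} ?f) {0..x}"
    using x \<alpha> by (subst has_integral_cong[symmetric]) auto
  moreover have cont: "continuous_on {0..x} ?h"
    using \<alpha> pos by (intro continuous_on_powr' continuous_intros) (auto simp: less_imp_neq[symmetric])
  then have "((\<lambda>r. (\<alpha> + 2) / x powr (\<alpha> + 2) * ?h r) has_integral
      (\<alpha> + 2) / x powr (\<alpha> + 2) * integral {0..x} ?h) {0..x}"
    by (intro has_integral_mult_right integrable_integral integrable_continuous_interval)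
  ultimately have sub: "integral {0..1} ?f = (\<alpha> + 2) / x powr (\<alpha> + 2) * integral {0..x} ?h"
    by (rule has_integral_unique)
  from cont have "set_integrable lborel {0..x} ?h"
    by (rule borel_integrable_atLeastAtMost')
  then have Psi: "Psi \<alpha> \<beta> x = integral {0..x} ?h"
    unfolding Psi_def by (rule set_borel_integral_eq_integral)
  have "?f integrable_on {0..1}"
    using a c by (intro integrable_continuous_interval continuous_on_powr' continuous_intros) (auto simp: add_nonneg_eq_0_iff)
  then have "((\<lambda>t. complex_of_real (?f t)) has_integral of_real (integral {0..1} ?f)) {0..1}"
    by (intro has_integral_of_real integrable_integral)
  then have "euler_2F1 a (of_real (- c)) = of_real (integral {0..1} ?f)"
    unfolding euler_2F1_def by (simp add: integral_unique)
  moreover have "gauss_2F1 1 (of_real a) (of_real (a + 1)) (of_real (- c)) = euler_2F1 a (of_real (- c))"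
    using c by (intro gauss_2F1_euler a) (auto simp flip: of_real_minus)
  moreover have "Psi \<alpha> \<beta> x = x powr (\<alpha> + 2) / (2 + \<alpha>) * integral {0..1} ?f"
    using sub Psi x \<alpha> by (simp add: add.commute)
  moreover have "gauss_2F1 1 (of_real (2 / \<alpha> + 1)) (of_real (2 / \<alpha> + 2)) (of_real (- (x powr \<alpha> / \<beta>))) =
      gauss_2F1 1 (of_real a) (of_real (a + 1)) (of_real (- c))"
    by (simp add: a_def c_def add.commute)
  ultimately show ?thesis by (simp only: of_real_mult)
qed


section \<open>Polar coordinates in the complex plane\<close>

text \<open>Lebesgue measure is determined by its values on boxes, and a box in the complex plane is
  a product of an interval of real parts and one of imaginary parts. This opens the way to iterated
  integrals.\<close>

lemma lborel_complex: "lborel = distr (lborel \<Otimes>\<^sub>M lborel) borel (\<lambda>(x, y). Complex x y)"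
proof (rule lborel_eqI)
  have [measurable]: "(\<lambda>(x, y). Complex x y) \<in> borel_measurable (lborel \<Otimes>\<^sub>M lborel)"
    unfolding Complex_eq by measurable
  fix l u :: complex
  assume le: "\<And>b. b \<in> Basis \<Longrightarrow> l \<bullet> b \<le> u \<bullet> b"
  have le': "Re l \<le> Re u" "Im l \<le> Im u"
    using le[of 1] le[of \<i>] by (auto simp: Basis_complex_def)
  have "(\<lambda>(x, y). Complex x y) -` box l u \<inter> space (lborel \<Otimes>\<^sub>M lborel)
          = {Re l<..<Re u} \<times> {Im l<..<Im u}"
    by (auto simp: box_def Basis_complex_def space_pair_measure)
  then have "emeasure (distr (lborel \<Otimes>\<^sub>M lborel) borel (\<lambda>(x, y). Complex x y)) (box l u)
          = emeasure (lborel \<Otimes>\<^sub>M lborel) ({Re l<..<Re u} \<times> {Im l<..<Im u})"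
    by (subst emeasure_distr) auto
  also have "\<dots> = ennreal (Re u - Re l) * ennreal (Im u - Im l)"
    using le' by (subst lborel.emeasure_pair_measure_Times) auto
  also have "\<dots> = (\<Prod>b\<in>Basis. (u - l) \<bullet> b)"
    using le' by (simp add: Basis_complex_def ennreal_mult)
  finally show "emeasure (distr (lborel \<Otimes>\<^sub>M lborel) borel (\<lambda>(x, y). Complex x y)) (box l u)
          = (\<Prod>b\<in>Basis. (u - l) \<bullet> b)" .
qed simp

lemma nn_integral_lborel_complex:
  assumes [measurable]: "h \<in> borel_measurable borel"
  shows "(\<integral>\<^sup>+z. h z \<partial>lborel) = (\<integral>\<^sup>+x. \<integral>\<^sup>+y. h (Complex x y) \<partial>lborel \<partial>lborel)"
proof -
  have m[measurable]: "(\<lambda>p. Complex (fst p) (snd p)) \<in> borel_measurable (lborel \<Otimes>\<^sub>M lborel)"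
    unfolding Complex_eq by measurable
  have "(\<integral>\<^sup>+z. h z \<partial>lborel) = (\<integral>\<^sup>+p. h (Complex (fst p) (snd p)) \<partial>(lborel \<Otimes>\<^sub>M lborel))"
    by (subst lborel_complex) (simp add: nn_integral_distr case_prod_beta)
  also have "\<dots> = (\<integral>\<^sup>+x. \<integral>\<^sup>+y. h (Complex x y) \<partial>lborel \<partial>lborel)"
    by (subst lborel.nn_integral_fst[symmetric]) auto
  finally show ?thesis .
qed

text \<open>Continuity from below of the measure \<open>density N f\<close>.\<close>

lemma nn_integral_incseq_Union:
  assumes A: "incseq A" "\<And>n. A n \<in> sets N" and f: "f \<in> borel_measurable N"
  shows "(\<integral>\<^sup>+x. f x * indicator (\<Union>n. A n) x \<partial>N) = (SUP n. \<integral>\<^sup>+x. f x * indicator (A n) x \<partial>N)"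
proof -
  have "range A \<subseteq> sets (density N f)" using A by auto
  from SUP_emeasure_incseq[OF this A(1)] show ?thesis
    using A(2) f by (simp add: emeasure_density sets.countable_UN)
qed

text \<open>The substitution rule works on compact intervals with continuous derivative, whereas tan
  is unbounded on its open interval. So the interval is exhausted by preimages of [-(n + 1), n + 1],
  and monotone convergence finishes.\<close>

lemma nn_integral_tan:
  fixes f :: "real \<Rightarrow> ennreal"
  assumes [measurable]: "f \<in> borel_measurable borel"
  shows "(\<integral>\<^sup>+t. f t \<partial>lborel) =
    (\<integral>\<^sup>+\<phi>. f (tan \<phi>) * ennreal (inverse ((cos \<phi>)\<^sup>2)) * indicator {-pi/2<..<pi/2} \<phi> \<partial>lborel)"
proof -
  \<comment> \<open>The shift by 1 keeps the interval nondegenerate already for n = 0, as the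
    substitution rule requires.\<close>
  let ?b = "\<lambda>n. arctan (real n + 1)"
  have cos_pos: "cos \<phi> > 0" if "\<phi> \<in> {-pi/2<..<pi/2}" for \<phi>
    using that by (intro cos_gt_zero_pi) auto
  have bb: "{-?b n..?b n} \<subseteq> {-pi/2<..<pi/2}" for n
    using arctan_bounded[of "real n + 1"] by auto
  have U1: "(\<Union>n. {-(real n + 1)..real n + 1}) = UNIV"
  proof safe
    fix x :: real
    obtain n where "\<bar>x\<bar> \<le> real n" using real_arch_simple by blast
    then show "x \<in> (\<Union>n. {-(real n + 1)..real n + 1})" by (intro UN_I[of n]) auto
  qed auto
  have U2: "(\<Union>n. {-?b n..?b n}) = {-pi/2<..<pi/2}"
  proof (intro equalityI subsetI)
    fix x assume "x \<in> {-pi/2<..<pi/2}"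
    then have x: "arctan (tan x) = x" by (intro arctan_tan) auto
    obtain n where n: "\<bar>tan x\<bar> \<le> real n" using real_arch_simple by blast
    have "arctan (tan x) \<le> ?b n" "arctan (- (real n + 1)) \<le> arctan (tan x)"
      using n by (auto intro!: arctan_monotone')
    then have "- ?b n \<le> x" "x \<le> ?b n" using x by (simp_all only: arctan_minus)
    then show "x \<in> (\<Union>n. {-?b n..?b n})" by (intro UN_I[of n]) auto
  qed (use bb in blast)
  have tanm[measurable]: "(tan :: real \<Rightarrow> real) \<in> borel_measurable borel"
    unfolding tan_def[abs_def] by measurable
  have "(\<integral>\<^sup>+t. f t \<partial>lborel) = (\<integral>\<^sup>+t. f t * indicator (\<Union>n. {-(real n + 1)..real n + 1}) t \<partial>lborel)"
    unfolding U1 by simp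
  also have "\<dots> = (SUP n. \<integral>\<^sup>+t. f t * indicator {-(real n + 1)..real n + 1} t \<partial>lborel)"
    by (intro nn_integral_incseq_Union) (auto simp: incseq_def)
  also have "\<dots> = (SUP n. \<integral>\<^sup>+\<phi>. f (tan \<phi>) * ennreal (inverse ((cos \<phi>)\<^sup>2)) * indicator {-?b n..?b n} \<phi> \<partial>lborel)"
  proof (intro SUP_cong refl)
    fix n
    have "(\<integral>\<^sup>+t. f t * indicator {tan (-?b n)..tan (?b n)} t \<partial>lborel) =
      (\<integral>\<^sup>+\<phi>. f (tan \<phi>) * ennreal (inverse ((cos \<phi>)\<^sup>2)) * indicator {-?b n..?b n} \<phi> \<partial>lborel)"
    proof (rule nn_integral_substitution_aux)
      fix \<phi> assume "\<phi> \<in> {-?b n..?b n}"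
      then have "cos \<phi> \<noteq> 0" using bb[of n] cos_pos[of \<phi>] by force
      then show "(tan has_real_derivative inverse ((cos \<phi>)\<^sup>2)) (at \<phi>)" by (rule DERIV_tan)
    next
      have "cos \<phi> \<noteq> 0" if "\<phi> \<in> {-?b n..?b n}" for \<phi>
        using bb[of n] cos_pos[of \<phi>] that by force
      then show "continuous_on {-?b n..?b n} (\<lambda>\<phi>. inverse ((cos \<phi>)\<^sup>2))"
        by (intro continuous_intros) auto
    next
      show "- ?b n < ?b n" by (simp add: arctan_less_iff)
    qed auto
    then show "(\<integral>\<^sup>+t. f t * indicator {-(real n + 1)..real n + 1} t \<partial>lborel) =
      (\<integral>\<^sup>+\<phi>. f (tan \<phi>) * ennreal (inverse ((cos \<phi>)\<^sup>2)) * indicator {-?b n..?b n} \<phi> \<partial>lborel)"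
      by (simp add: tan_arctan)
  qed
  also have "\<dots> = (\<integral>\<^sup>+\<phi>. f (tan \<phi>) * ennreal (inverse ((cos \<phi>)\<^sup>2)) * indicator (\<Union>n. {-?b n..?b n}) \<phi> \<partial>lborel)"
    by (intro nn_integral_incseq_Union[symmetric])
       (auto simp: incseq_def arctan_le_iff intro: order_trans)
  finally show ?thesis unfolding U2 .
qed

text \<open>Polar coordinates by one-dimensional substitutions only: \<open>y = x t\<close>, then \<open>t = tan \<phi>\<close>,
  then \<open>x = r cos \<phi>\<close>.\<close>

lemma nn_integral_halfplane_polar:
  fixes h :: "complex \<Rightarrow> ennreal"
  assumes [measurable]: "h \<in> borel_measurable borel"
  shows "(\<integral>\<^sup>+z. h z \<partial>lborel) =
    (\<integral>\<^sup>+\<phi>. (\<integral>\<^sup>+r. ennreal \<bar>r\<bar> * h (of_real r * cis \<phi>) \<partial>lborel) * indicator {-pi/2<..<pi/2} \<phi> \<partial>lborel)"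
proof -
  have C[measurable]: "(\<lambda>p. Complex (fst p) (snd p)) \<in> borel_measurable (borel \<Otimes>\<^sub>M borel)"
    unfolding Complex_eq by measurable
  have C1[measurable]: "(\<lambda>y. Complex x y) \<in> borel_measurable borel" for x
    unfolding Complex_eq by measurable
  have C2[measurable]: "(\<lambda>x. Complex x (x * t)) \<in> borel_measurable borel" for t
    unfolding Complex_eq by measurable
  have C3[measurable]: "(\<lambda>p. Complex (fst p) (fst p * snd p)) \<in> borel_measurable (lborel \<Otimes>\<^sub>M lborel)"
    unfolding Complex_eq by measurable
  have C4[measurable]: "(\<lambda>p. Complex (snd p) (snd p * fst p)) \<in> borel_measurable (borel \<Otimes>\<^sub>M lborel)"
    unfolding Complex_eq by measurable
  have "(\<integral>\<^sup>+z. h z \<partial>lborel) = (\<integral>\<^sup>+x. \<integral>\<^sup>+y. h (Complex x y) \<partial>lborel \<partial>lborel)"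
    by (rule nn_integral_lborel_complex) fact
  also have "\<dots> = (\<integral>\<^sup>+x. \<integral>\<^sup>+t. ennreal \<bar>x\<bar> * h (Complex x (x * t)) \<partial>lborel \<partial>lborel)"
  proof (rule nn_integral_cong_AE)
    \<comment> \<open>The scaling y = x t degenerates on the line x = 0, which is a null
      set.\<close>
    have "AE x in lborel. x \<noteq> (0::real)" by (rule AE_lborel_singleton)
    then show "AE x in lborel. (\<integral>\<^sup>+y. h (Complex x y) \<partial>lborel) = (\<integral>\<^sup>+t. ennreal \<bar>x\<bar> * h (Complex x (x * t)) \<partial>lborel)"
    proof eventually_elim
      case (elim x)
      then show ?case
        by (subst nn_integral_real_affine[where t = 0 and c = x]) (auto simp: nn_integral_cmult)
    qed
  qed
  also have "\<dots> = (\<integral>\<^sup>+t. \<integral>\<^sup>+x. ennreal \<bar>x\<bar> * h (Complex x (x * t)) \<partial>lborel \<partial>lborel)"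
    by (rule lborel_pair.Fubini'[symmetric]) (simp add: case_prod_beta)
  also have "\<dots> = (\<integral>\<^sup>+\<phi>. (\<integral>\<^sup>+x. ennreal \<bar>x\<bar> * h (Complex x (x * tan \<phi>)) \<partial>lborel) *
       ennreal (inverse ((cos \<phi>)\<^sup>2)) * indicator {-pi/2<..<pi/2} \<phi> \<partial>lborel)"
    by (rule nn_integral_tan) (auto intro!: lborel.borel_measurable_nn_integral simp: case_prod_beta)
  also have "\<dots> = (\<integral>\<^sup>+\<phi>. (\<integral>\<^sup>+r. ennreal \<bar>r\<bar> * h (of_real r * cis \<phi>) \<partial>lborel) * indicator {-pi/2<..<pi/2} \<phi> \<partial>lborel)"
  proof (rule nn_integral_cong)
    fix \<phi> :: real
    show "(\<integral>\<^sup>+x. ennreal \<bar>x\<bar> * h (Complex x (x * tan \<phi>)) \<partial>lborel) *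
       ennreal (inverse ((cos \<phi>)\<^sup>2)) * indicator {-pi/2<..<pi/2} \<phi> =
       (\<integral>\<^sup>+r. ennreal \<bar>r\<bar> * h (of_real r * cis \<phi>) \<partial>lborel) * indicator {-pi/2<..<pi/2} \<phi>"
    proof (cases "\<phi> \<in> {-pi/2<..<pi/2}")
      case True
      then have cp: "cos \<phi> > 0" by (intro cos_gt_zero_pi) auto
      have "(\<integral>\<^sup>+x. ennreal \<bar>x\<bar> * h (Complex x (x * tan \<phi>)) \<partial>lborel) =
        ennreal (cos \<phi>) * (\<integral>\<^sup>+r. ennreal \<bar>cos \<phi> * r\<bar> * h (Complex (cos \<phi> * r) (cos \<phi> * r * tan \<phi>)) \<partial>lborel)"
        using cp by (subst nn_integral_real_affine[where t = 0 and c = "cos \<phi>"]) auto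
      also have "\<dots> = ennreal (cos \<phi>) * (\<integral>\<^sup>+r. ennreal (cos \<phi>) * (ennreal \<bar>r\<bar> * h (of_real r * cis \<phi>)) \<partial>lborel)"
      proof -
        have "Complex (cos \<phi> * r) (cos \<phi> * r * tan \<phi>) = of_real r * cis \<phi>" for r
          using cp by (simp add: complex_eq_iff tan_def)
        then show ?thesis
          using cp by (simp add: abs_mult ennreal_mult mult.assoc)
      qed
      \<comment> \<open>One factor cos \<phi> comes from dx = cos \<phi> dr, the other from |x| =
        cos \<phi> |r|; their product cancels the derivative of tan. The radius r is signed, so
        angles in an open half-circle cover both half-planes.\<close>
      also have "\<dots> = ennreal ((cos \<phi>)\<^sup>2) * (\<integral>\<^sup>+r. ennreal \<bar>r\<bar> * h (of_real r * cis \<phi>) \<partial>lborel)"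
        using cp by (simp add: nn_integral_cmult ennreal_mult power2_eq_square mult.assoc)
      finally have "(\<integral>\<^sup>+x. ennreal \<bar>x\<bar> * h (Complex x (x * tan \<phi>)) \<partial>lborel) * ennreal (inverse ((cos \<phi>)\<^sup>2))
        = ennreal ((cos \<phi>)\<^sup>2 * inverse ((cos \<phi>)\<^sup>2)) * (\<integral>\<^sup>+r. ennreal \<bar>r\<bar> * h (of_real r * cis \<phi>) \<partial>lborel)"
        by (subst ennreal_mult) (auto simp: mult_ac)
      then show ?thesis using cp by simp
    qed simp
  qed
  finally show ?thesis .
qed

lemma nn_integral_shift_indicator:
  fixes k :: "real \<Rightarrow> ennreal"
  assumes [measurable]: "k \<in> borel_measurable borel"
  shows "(\<integral>\<^sup>+x. k (x + c) * indicator {a..<b} x \<partial>lborel) = (\<integral>\<^sup>+x. k x * indicator {a + c..<b + c} x \<partial>lborel)"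
proof -
  have "(\<integral>\<^sup>+x. k x * indicator {a + c..<b + c} x \<partial>lborel) = (\<integral>\<^sup>+x. k (c + 1 * x) * indicator {a + c..<b + c} (c + 1 * x) \<partial>lborel)"
    by (subst nn_integral_real_affine[where t = c and c = 1]) auto
  also have "\<dots> = (\<integral>\<^sup>+x. k (x + c) * indicator {a..<b} x \<partial>lborel)"
    by (intro nn_integral_cong) (auto simp: indicator_def add.commute)
  finally show ?thesis ..
qed

lemma nn_integral_indicator_split:
  fixes k :: "real \<Rightarrow> ennreal"
  assumes [measurable]: "k \<in> borel_measurable borel" and "a \<le> b" "b \<le> c"
  shows "(\<integral>\<^sup>+x. k x * indicator {a..<c} x \<partial>lborel) =
    (\<integral>\<^sup>+x. k x * indicator {a..<b} x \<partial>lborel) + (\<integral>\<^sup>+x. k x * indicator {b..<c} x \<partial>lborel)"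
proof -
  have "(\<integral>\<^sup>+x. k x * indicator {a..<c} x \<partial>lborel) =
     (\<integral>\<^sup>+x. k x * indicator {a..<b} x + k x * indicator {b..<c} x \<partial>lborel)"
    using assms by (intro nn_integral_cong) (auto simp: indicator_def)
  then show ?thesis by (simp add: nn_integral_add)
qed

lemma nn_integral_periodic:
  fixes k :: "real \<Rightarrow> ennreal"
  assumes [measurable]: "k \<in> borel_measurable borel" and T: "T > 0" and per: "\<And>x. k (x + T) = k x"
  shows "(\<integral>\<^sup>+x. k x * indicator {a..<a + T} x \<partial>lborel) = (\<integral>\<^sup>+x. k x * indicator {b..<b + T} x \<partial>lborel)"
proof -
  have per_nat: "k (x + real n * T) = k x" for n x
  proof (induction n)
    case (Suc n)
    have "k (x + real (Suc n) * T) = k ((x + real n * T) + T)" by (simp add: algebra_simps)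
    then show ?case using Suc per by simp
  qed simp
  have per_int: "k (x + of_int m * T) = k x" for m x
  proof (cases "m \<ge> 0")
    case True
    then show ?thesis using per_nat[of x "nat m"] by simp
  next
    case False
    then show ?thesis using per_nat[of "x + of_int m * T" "nat (- m)"] by (simp add: algebra_simps)
  qed
  have "(\<integral>\<^sup>+x. k x * indicator {a..<a + T} x \<partial>lborel) = (\<integral>\<^sup>+x. k x * indicator {0..<T} x \<partial>lborel)" for a
  proof -
    \<comment> \<open>The last multiple of T not exceeding a. The part of the window beyond c + T is
      moved back by T onto [c, a), giving the window [c, c + T), which is then translated to [0,
      T).\<close>
    define c where "c = of_int \<lfloor>a / T\<rfloor> * T"
    have "of_int \<lfloor>a / T\<rfloor> \<le> a / T" "a / T \<le> of_int \<lfloor>a / T\<rfloor> + 1" by linarith+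
    then have "of_int \<lfloor>a / T\<rfloor> * T \<le> a / T * T" "a / T * T \<le> (of_int \<lfloor>a / T\<rfloor> + 1) * T"
      using T by (intro mult_right_mono; simp)+
    then have c: "c \<le> a" "a \<le> c + T" using T by (simp_all add: c_def distrib_right)
    have "(\<integral>\<^sup>+x. k x * indicator {a..<a + T} x \<partial>lborel) =
      (\<integral>\<^sup>+x. k x * indicator {a..<c + T} x \<partial>lborel) + (\<integral>\<^sup>+x. k x * indicator {c + T..<a + T} x \<partial>lborel)"
      using c by (intro nn_integral_indicator_split) auto
    also have "(\<integral>\<^sup>+x. k x * indicator {c + T..<a + T} x \<partial>lborel) = (\<integral>\<^sup>+x. k x * indicator {c..<a} x \<partial>lborel)"
      using nn_integral_shift_indicator[of k T c a] by (simp add: per)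
    also have "(\<integral>\<^sup>+x. k x * indicator {a..<c + T} x \<partial>lborel) + (\<integral>\<^sup>+x. k x * indicator {c..<a} x \<partial>lborel)
      = (\<integral>\<^sup>+x. k x * indicator {c..<c + T} x \<partial>lborel)"
      using c by (subst nn_integral_indicator_split[of k c a "c + T"]) (auto simp: add.commute)
    also have "\<dots> = (\<integral>\<^sup>+x. k x * indicator {0..<T} x \<partial>lborel)"
      using nn_integral_shift_indicator[of k c 0 T] by (simp add: per_int c_def add.commute)
    finally show ?thesis .
  qed
  from this[of a] this[of b] show ?thesis by simp
qed

text \<open>Signed radii are folded: a negative r at angle \<phi> is the radius -r at angle \<phi> +
  pi, so the half-circle becomes a full one. The starting angle a is left free because later uses
  begin at \<theta> or at pi.\<close>

lemma nn_integral_polar: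
  fixes h :: "complex \<Rightarrow> ennreal"
  assumes [measurable]: "h \<in> borel_measurable borel"
  shows "(\<integral>\<^sup>+z. h z \<partial>lborel) =
    (\<integral>\<^sup>+r. ennreal r * (\<integral>\<^sup>+\<phi>. h (of_real r * cis \<phi>) * indicator {a..<a + 2 * pi} \<phi> \<partial>lborel) * indicator {0..} r \<partial>lborel)"
proof -
  have cism[measurable]: "cis \<in> borel_measurable borel"
    by (intro borel_measurable_continuous_onI continuous_intros)
  define K where "K \<phi> = (\<integral>\<^sup>+r. ennreal r * h (of_real r * cis \<phi>) * indicator {0..} r \<partial>lborel)" for \<phi>
  have [measurable]: "K \<in> borel_measurable borel"
    unfolding K_def[abs_def] by measurable
  have split: "(\<integral>\<^sup>+r. ennreal \<bar>r\<bar> * h (of_real r * cis \<phi>) \<partial>lborel) = K \<phi> + K (\<phi> + pi)" for \<phi>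
  proof -
    have "(\<integral>\<^sup>+r. ennreal \<bar>r\<bar> * h (of_real r * cis \<phi>) \<partial>lborel) =
       (\<integral>\<^sup>+r. ennreal r * h (of_real r * cis \<phi>) * indicator {0..} r + ennreal (- r) * h (of_real r * cis \<phi>) * indicator {0..} (- r) \<partial>lborel)"
      by (intro nn_integral_cong) (auto simp: indicator_def)
    also have "\<dots> = K \<phi> + (\<integral>\<^sup>+r. ennreal (- r) * h (of_real r * cis \<phi>) * indicator {0..} (- r) \<partial>lborel)"
      unfolding K_def by (rule nn_integral_add) measurable
    also have "(\<integral>\<^sup>+r. ennreal (- r) * h (of_real r * cis \<phi>) * indicator {0..} (- r) \<partial>lborel) = K (\<phi> + pi)"
      unfolding K_def by (subst nn_integral_real_affine[where t = 0 and c = "-1"]) 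
        (auto simp flip: cis_mult)
    finally show ?thesis .
  qed
  have "(\<integral>\<^sup>+z. h z \<partial>lborel) = (\<integral>\<^sup>+\<phi>. (K \<phi> + K (\<phi> + pi)) * indicator {-pi/2<..<pi/2} \<phi> \<partial>lborel)"
    by (subst nn_integral_halfplane_polar) (auto simp: split)
  also have "\<dots> = (\<integral>\<^sup>+\<phi>. K \<phi> * indicator {-pi/2..<pi/2} \<phi> + K (\<phi> + pi) * indicator {-pi/2..<pi/2} \<phi> \<partial>lborel)"
  proof (rule nn_integral_cong_AE)
    have "AE x in lborel. x \<noteq> (-pi/2::real)" by (rule AE_lborel_singleton)
    then show "AE \<phi> in lborel. (K \<phi> + K (\<phi> + pi)) * indicator {-pi/2<..<pi/2} \<phi> =
        K \<phi> * indicator {-pi/2..<pi/2} \<phi> + K (\<phi> + pi) * indicator {-pi/2..<pi/2} \<phi>"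
      by eventually_elim (auto simp: indicator_def)
  qed
  also have "\<dots> = (\<integral>\<^sup>+\<phi>. K \<phi> * indicator {-pi/2..<pi/2} \<phi> \<partial>lborel) +
      (\<integral>\<^sup>+\<phi>. K (\<phi> + pi) * indicator {-pi/2..<pi/2} \<phi> \<partial>lborel)"
    by (rule nn_integral_add) auto
  \<comment> \<open>The second half-window, shifted by pi, starts where the first one ends.\<close>
  also have "\<dots> = (\<integral>\<^sup>+\<phi>. K \<phi> * indicator {-pi/2..<-pi/2 + 2 * pi} \<phi> \<partial>lborel)"
    by (subst nn_integral_shift_indicator, simp, subst nn_integral_indicator_split[of K "-pi/2" "pi/2" "-pi/2 + 2 * pi"])
       (auto simp: field_simps)
  also have "\<dots> = (\<integral>\<^sup>+\<phi>. K \<phi> * indicator {a..<a + 2 * pi} \<phi> \<partial>lborel)"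
    by (rule nn_integral_periodic) (auto simp: K_def simp flip: cis_mult)
  also have "\<dots> = (\<integral>\<^sup>+\<phi>. (\<integral>\<^sup>+r. ennreal r * h (of_real r * cis \<phi>) * indicator {0..} r * indicator {a..<a + 2 * pi} \<phi> \<partial>lborel) \<partial>lborel)"
    unfolding K_def by (intro nn_integral_cong nn_integral_multc[symmetric]) measurable
  also have "\<dots> = (\<integral>\<^sup>+r. (\<integral>\<^sup>+\<phi>. ennreal r * h (of_real r * cis \<phi>) * indicator {0..} r * indicator {a..<a + 2 * pi} \<phi> \<partial>lborel) \<partial>lborel)"
    by (rule lborel_pair.Fubini'[symmetric]) (simp add: case_prod_beta)
  also have "\<dots> = (\<integral>\<^sup>+r. ennreal r * (\<integral>\<^sup>+\<phi>. h (of_real r * cis \<phi>) * indicator {a..<a + 2 * pi} \<phi> \<partial>lborel) * indicator {0..} r \<partial>lborel)"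
  proof (intro nn_integral_cong)
    fix r :: real
    have "(\<integral>\<^sup>+\<phi>. ennreal r * h (of_real r * cis \<phi>) * indicator {0..} r * indicator {a..<a + 2 * pi} \<phi> \<partial>lborel) =
      (\<integral>\<^sup>+\<phi>. (ennreal r * indicator {0..} r) * (h (of_real r * cis \<phi>) * indicator {a..<a + 2 * pi} \<phi>) \<partial>lborel)"
      by (simp add: mult_ac)
    also have "\<dots> = (ennreal r * indicator {0..} r) * (\<integral>\<^sup>+\<phi>. h (of_real r * cis \<phi>) * indicator {a..<a + 2 * pi} \<phi> \<partial>lborel)"
      by (rule nn_integral_cmult) measurable
    finally show "(\<integral>\<^sup>+\<phi>. ennreal r * h (of_real r * cis \<phi>) * indicator {0..} r * indicator {a..<a + 2 * pi} \<phi> \<partial>lborel)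
      = ennreal r * (\<integral>\<^sup>+\<phi>. h (of_real r * cis \<phi>) * indicator {a..<a + 2 * pi} \<phi> \<partial>lborel) * indicator {0..} r"
      by (simp add: mult_ac)
  qed
  finally show ?thesis .
qed


section \<open>Averages over the disk\<close>

text \<open>The bridge from nonnegative integrals to the real set integrals in \<open>Psi\<close>,
  \<open>calZ1\<close> and \<open>calX\<close>; a bound on a compact interval supplies
  integrability.\<close>

lemma nn_integral_set_bounded:
  fixes k :: "real \<Rightarrow> real"
  assumes [measurable]: "k \<in> borel_measurable borel"
    and bd: "\<And>x. x \<in> {a..b} \<Longrightarrow> 0 \<le> k x \<and> k x \<le> B"
  shows "(\<integral>\<^sup>+x. ennreal (k x) * indicator {a..b} x \<partial>lborel) = ennreal (LINT x:{a..b}|lborel. k x)"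
proof -
  have "integrable lborel (\<lambda>x. indicator {a..b} x *\<^sub>R k x)"
    by (rule integrableI_bounded_set_indicator[where B = B])
       (use bd in \<open>auto simp: emeasure_lborel_Icc_eq\<close>)
  then have "(\<integral>\<^sup>+x. ennreal (indicator {a..b} x *\<^sub>R k x) \<partial>lborel) = ennreal (LINT x:{a..b}|lborel. k x)"
    unfolding set_lebesgue_integral_def
    by (rule nn_integral_eq_integral) (use bd in \<open>auto simp: indicator_def\<close>)
  moreover have "(\<integral>\<^sup>+x. ennreal (indicator {a..b} x *\<^sub>R k x) \<partial>lborel) = (\<integral>\<^sup>+x. ennreal (k x) * indicator {a..b} x \<partial>lborel)"
    by (intro nn_integral_cong) (auto simp: indicator_def)
  ultimately show ?thesis by simp
qed

text \<open>By the law of cosines the condition is cos (\<phi> - pi) \<ge> c, an arc centred at the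
  direction pi, which points from the receiver to the centre of the disk. Clipping c to [-1, 1]
  covers the degenerate cases: below -1 the whole circle lies inside, above 1 it misses the
  disk.\<close>

lemma arc_length_in_disk:
  assumes r0: "r0 > 0" and R: "R \<ge> r0" and s: "s > 0"
  shows "emeasure lborel {\<phi> \<in> {0..<2 * pi}. cmod (of_real r0 + of_real (r0 * s) * cis \<phi>) \<le> R} =
    ennreal (2 * arccos (max (-1) (min 1 ((r0\<^sup>2 * s\<^sup>2 + r0\<^sup>2 - R\<^sup>2) / (2 * r0\<^sup>2 * s)))))"
proof -
  define c where "c = (r0\<^sup>2 * s\<^sup>2 + r0\<^sup>2 - R\<^sup>2) / (2 * r0\<^sup>2 * s)"
  have iff: "cmod (of_real r0 + of_real (r0 * s) * cis \<phi>) \<le> R \<longleftrightarrow> c \<le> cos (\<phi> - pi)" for \<phi>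
  proof -
    have "(cmod (of_real r0 + of_real (r0 * s) * cis \<phi>))\<^sup>2 = (r0 + r0 * s * cos \<phi>)\<^sup>2 + (r0 * s * sin \<phi>)\<^sup>2"
      by (simp add: cmod_power2)
    also have "\<dots> = r0\<^sup>2 + 2 * r0\<^sup>2 * s * cos \<phi> + r0\<^sup>2 * s\<^sup>2 * ((sin \<phi>)\<^sup>2 + (cos \<phi>)\<^sup>2)"
      by algebra
    also have "\<dots> = r0\<^sup>2 + 2 * r0\<^sup>2 * s * cos \<phi> + r0\<^sup>2 * s\<^sup>2" by simp
    finally have eq: "(cmod (of_real r0 + of_real (r0 * s) * cis \<phi>))\<^sup>2 = r0\<^sup>2 + 2 * r0\<^sup>2 * s * cos \<phi> + r0\<^sup>2 * s\<^sup>2" .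
    have "cmod (of_real r0 + of_real (r0 * s) * cis \<phi>) \<le> R \<longleftrightarrow> (cmod (of_real r0 + of_real (r0 * s) * cis \<phi>))\<^sup>2 \<le> R\<^sup>2"
      using r0 R by (intro abs_le_square_iff[of _ R, simplified, THEN trans[rotated]]) auto
    also have "\<dots> \<longleftrightarrow> r0\<^sup>2 * s\<^sup>2 + r0\<^sup>2 - R\<^sup>2 \<le> - cos \<phi> * (2 * r0\<^sup>2 * s)"
      unfolding eq by (auto simp: algebra_simps)
    also have "\<dots> \<longleftrightarrow> c \<le> - cos \<phi>"
      unfolding c_def using r0 s by (intro pos_divide_le_eq[symmetric]) auto
    finally show ?thesis by (simp add: cos_diff)
  qed
  define A where "A = arccos (max (-1) (min 1 c))"
  have "{\<phi> \<in> {0..<2 * pi}. c \<le> cos (\<phi> - pi)} =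
     (if c > 1 then {} else {pi - A..pi + A} \<inter> {0..<2 * pi})"
  proof (cases "c > 1")
    case True
    have "\<not> c \<le> cos x" for x using True cos_le_one[of x] by linarith
    then have "{\<phi> \<in> {0..<2 * pi}. c \<le> cos (\<phi> - pi)} = {}" by blast
    with True show ?thesis by (simp only: if_True)
  next
    case False
    have cos_A: "cos A = max (-1) c" using False unfolding A_def by (subst cos_arccos) auto
    have A: "0 \<le> A" "A \<le> pi" unfolding A_def by (auto intro!: arccos_lbound arccos_ubound)
    have "c \<le> cos (\<phi> - pi) \<longleftrightarrow> \<bar>\<phi> - pi\<bar> \<le> A" if "\<phi> \<in> {0..<2 * pi}" for \<phi>
    proof -
      have "c \<le> cos (\<phi> - pi) \<longleftrightarrow> cos A \<le> cos \<bar>\<phi> - pi\<bar>"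
        using cos_ge_minus_one[of "\<phi> - pi"] unfolding cos_A cos_abs_real by auto
      also have "\<dots> \<longleftrightarrow> \<bar>\<phi> - pi\<bar> \<le> A"
        using A that by (intro cos_mono_le_eq) auto
      finally show ?thesis .
    qed
    with False show ?thesis by auto
  qed
  moreover have "emeasure lborel ({pi - A..pi + A} \<inter> {0..<2 * pi}) = ennreal (2 * A)" if "c \<le> 1"
  proof (cases "A < pi")
    case True
    have "0 \<le> A" unfolding A_def by (auto intro!: arccos_lbound)
    moreover have "{pi - A..pi + A} \<inter> {0..<2 * pi} = {pi - A..pi + A}" using True by auto
    ultimately show ?thesis by simp
  next
    case False
    moreover have "A \<le> pi" unfolding A_def by (auto intro!: arccos_ubound)
    ultimately have "A = pi" by simp
    \<comment> \<open>For the full circle the half-open window drops only the endpoint 2 pi, which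
      has no length.\<close>
    moreover have "{0..pi + pi} \<inter> {0..<2 * pi} = {0..<2 * pi}" by auto
    ultimately show ?thesis by simp
  qed
  moreover have "A = 0" if "c > 1" using that unfolding A_def by simp
  ultimately show ?thesis
    unfolding iff c_def[symmetric] A_def[symmetric] by (auto simp: not_less)
qed

text \<open>Continuity of \<open>arccos\<close> is available on [-1, 1] only; the clip keeps the
  argument there.\<close>

lemma measurable_arccos_clip [measurable]:
  "(\<lambda>x. arccos (max (-1) (min 1 x))) \<in> borel_measurable borel"
  by (intro borel_measurable_continuous_onI continuous_on_arccos continuous_intros) auto

text \<open>The receiver is translated to the origin before passing to polar coordinates. Rescaling
  the radius as r = r0 s produces r0 twice, from dr and from the Jacobian r.\<close>

lemma nn_integral_disk_around:
  fixes f :: "real \<Rightarrow> ennreal"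
  assumes [measurable]: "f \<in> borel_measurable borel" and r0: "r0 > 0" and R: "R \<ge> r0"
  shows "(\<integral>\<^sup>+z. f (cmod (z - of_real r0 * cis \<theta>) / r0) * indicator (cball 0 R) z \<partial>lborel) =
    ennreal (r0\<^sup>2) * (\<integral>\<^sup>+s. ennreal s * f s *
       ennreal (2 * arccos (max (-1) (min 1 ((r0\<^sup>2 * s\<^sup>2 + r0\<^sup>2 - R\<^sup>2) / (2 * r0\<^sup>2 * s))))) * indicator {0..} s \<partial>lborel)"
proof -
  have cism[measurable]: "cis \<in> borel_measurable borel"
    by (intro borel_measurable_continuous_onI continuous_intros)
  have [measurable]: "Measurable.pred borel (\<lambda>z::complex. z \<in> cball 0 R)"
    by (simp add: pred_def)
  let ?Y = "of_real r0 * cis \<theta>"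
  let ?arc = "\<lambda>r. emeasure lborel {\<phi> \<in> {0..<2 * pi}. cmod (of_real r0 + of_real r * cis \<phi>) \<le> R}"
  \<comment> \<open>The angular window starts at \<theta>, so that shifting by \<theta> turns it
    into [0, 2 pi).\<close>
  have arc: "(\<integral>\<^sup>+\<phi>. indicator (cball 0 R) (?Y + of_real r * cis \<phi>) * indicator {\<theta>..<\<theta> + 2 * pi} \<phi> \<partial>lborel) = ?arc r" for r
  proof -
    have "(\<integral>\<^sup>+\<phi>. indicator (cball 0 R) (?Y + of_real r * cis \<phi>) * indicator {\<theta>..<\<theta> + 2 * pi} \<phi> \<partial>lborel) =
      (\<integral>\<^sup>+\<phi>. indicator (cball 0 R) (?Y + of_real r * cis (\<phi> + \<theta>)) * indicator {0..<2 * pi} \<phi> \<partial>lborel)"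
    proof -
      have "(\<lambda>\<phi>. indicator (cball 0 R) (?Y + of_real r * cis \<phi>) :: ennreal) \<in> borel_measurable borel"
        by (rule measurable_compose[OF _ borel_measurable_indicator[of "cball 0 R" borel]]) measurable
      from nn_integral_shift_indicator[OF this, of \<theta> 0 "2 * pi"] show ?thesis
        by (simp add: add.commute)
    qed
    also have "\<dots> = (\<integral>\<^sup>+\<phi>. indicator {\<phi> \<in> {0..<2 * pi}. cmod (of_real r0 + of_real r * cis \<phi>) \<le> R} \<phi> \<partial>lborel)"
    proof (intro nn_integral_cong)
      fix \<phi>
      \<comment> \<open>Rotation about the centre of the disk carries the receiver to the positive
        real axis and preserves the disk.\<close>
      have "?Y + of_real r * cis (\<phi> + \<theta>) = cis \<theta> * (of_real r0 + of_real r * cis \<phi>)"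
        by (simp add: cis_mult[symmetric] algebra_simps)
      then have "cmod (?Y + of_real r * cis (\<phi> + \<theta>)) = cmod (of_real r0 + of_real r * cis \<phi>)"
        by (simp add: norm_mult)
      then show "indicator (cball 0 R) (?Y + of_real r * cis (\<phi> + \<theta>)) * indicator {0..<2 * pi} \<phi> =
         (indicator {\<phi> \<in> {0..<2 * pi}. cmod (of_real r0 + of_real r * cis \<phi>) \<le> R} \<phi> :: ennreal)"
        by (auto simp: indicator_def)
    qed
    finally show ?thesis by (subst (asm) nn_integral_indicator) auto
  qed
  have arcm[measurable]: "?arc \<in> borel_measurable borel"
  proof -
    have "(\<lambda>p. indicator (cball 0 R) (?Y + of_real (fst p) * cis (snd p)) * indicator {\<theta>..<\<theta> + 2 * pi} (snd p) :: ennreal)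
        \<in> borel_measurable (borel \<Otimes>\<^sub>M lborel)"
      by (intro borel_measurable_times_ennreal measurable_compose[OF _ borel_measurable_indicator]) measurable
    from lborel.borel_measurable_nn_integral_fst[OF this] show ?thesis
      unfolding arc[symmetric] by simp
  qed
  have "(\<integral>\<^sup>+z. f (cmod (z - ?Y) / r0) * indicator (cball 0 R) z \<partial>lborel) =
     (\<integral>\<^sup>+z. f (cmod (z - ?Y) / r0) * indicator (cball 0 R) z \<partial>distr lborel borel ((+) ?Y))"
    by (simp add: lborel_distr_plus)
  also have "\<dots> = (\<integral>\<^sup>+z. f (cmod z / r0) * indicator (cball 0 R) (?Y + z) \<partial>lborel)"
    by (subst nn_integral_distr) auto
  also have "\<dots> = (\<integral>\<^sup>+r. ennreal r * (\<integral>\<^sup>+\<phi>. f (cmod (of_real r * cis \<phi>) / r0) *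
        indicator (cball 0 R) (?Y + of_real r * cis \<phi>) * indicator {\<theta>..<\<theta> + 2 * pi} \<phi> \<partial>lborel) * indicator {0..} r \<partial>lborel)"
    by (rule nn_integral_polar) measurable
  also have "\<dots> = (\<integral>\<^sup>+r. ennreal r * f (r / r0) * ?arc r * indicator {0..} r \<partial>lborel)"
  proof (intro nn_integral_cong)
    fix r :: real
    have "(\<integral>\<^sup>+\<phi>. f (cmod (of_real r * cis \<phi>) / r0) *
        indicator (cball 0 R) (?Y + of_real r * cis \<phi>) * indicator {\<theta>..<\<theta> + 2 * pi} \<phi> \<partial>lborel) = f (r / r0) * ?arc r"
      if "r \<ge> 0"
      unfolding arc[symmetric] using that
      by (subst nn_integral_cmult[symmetric]) (auto simp: norm_mult mult.assoc)
    then show "ennreal r * (\<integral>\<^sup>+\<phi>. f (cmod (of_real r * cis \<phi>) / r0) *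
        indicator (cball 0 R) (?Y + of_real r * cis \<phi>) * indicator {\<theta>..<\<theta> + 2 * pi} \<phi> \<partial>lborel) * indicator {0..} r
      = ennreal r * f (r / r0) * ?arc r * indicator {0..} r"
      by (cases "r \<ge> 0") (auto simp: mult.assoc)
  qed
  also have "\<dots> = ennreal r0 * (\<integral>\<^sup>+s. ennreal (r0 * s) * f s * ?arc (r0 * s) * indicator {0..} (r0 * s) \<partial>lborel)"
    using r0 by (subst nn_integral_real_affine[where t = 0 and c = r0]) auto
  also have "\<dots> = ennreal r0 * (\<integral>\<^sup>+s. ennreal r0 * (ennreal s * f s *
       ennreal (2 * arccos (max (-1) (min 1 ((r0\<^sup>2 * s\<^sup>2 + r0\<^sup>2 - R\<^sup>2) / (2 * r0\<^sup>2 * s))))) * indicator {0..} s) \<partial>lborel)"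
  proof (rule arg_cong2[where f = "(*)"], rule refl, rule nn_integral_cong)
    fix s :: real
    consider "s < 0" | "s = 0" | "s > 0" by linarith
    then show "ennreal (r0 * s) * f s * ?arc (r0 * s) * indicator {0..} (r0 * s) = ennreal r0 * (ennreal s * f s *
       ennreal (2 * arccos (max (-1) (min 1 ((r0\<^sup>2 * s\<^sup>2 + r0\<^sup>2 - R\<^sup>2) / (2 * r0\<^sup>2 * s))))) * indicator {0..} s)"
    proof cases
      case 1
      then have "r0 * s < 0" using r0 by (simp add: mult_pos_neg)
      with 1 show ?thesis by simp
    next
      case 3
      then show ?thesis using r0 arc_length_in_disk[OF r0 R 3] by (simp add: ennreal_mult mult.assoc)
    qed simp
  qed
  also have "\<dots> = ennreal (r0\<^sup>2) * (\<integral>\<^sup>+s. ennreal s * f s *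
       ennreal (2 * arccos (max (-1) (min 1 ((r0\<^sup>2 * s\<^sup>2 + r0\<^sup>2 - R\<^sup>2) / (2 * r0\<^sup>2 * s))))) * indicator {0..} s \<partial>lborel)"
    using r0 by (subst nn_integral_cmult) (auto simp: power2_eq_square ennreal_mult mult.assoc)
  finally show ?thesis .
qed

text \<open>For s > 0 this is 1 / (1 + \<beta> s^(-\<alpha>)): the Laplace transform of a unit
  exponential gain at \<beta> s^(-\<alpha>), that is, the success factor of an interferer that
  always transmits.\<close>

definition attenuation :: "real \<Rightarrow> real \<Rightarrow> real \<Rightarrow> real" where
  "attenuation \<alpha> \<beta> s = s powr \<alpha> / (\<beta> + s powr \<alpha>)"

lemma attenuation_bounds:
  assumes "\<beta> > 0"
  shows "0 \<le> attenuation \<alpha> \<beta> s" "attenuation \<alpha> \<beta> s \<le> 1"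
  using assms by (auto simp: attenuation_def divide_simps add_pos_nonneg)

lemma attenuation_measurable [measurable]: "attenuation \<alpha> \<beta> \<in> borel_measurable borel"
  unfolding attenuation_def[abs_def] by measurable

text \<open>Completing squares gives c \<ge> -1 iff R \<le> r0 s + r0, and c \<le> 1 iff |r0 s - r0|
  \<le> R. Hence the limits of \<open>calZ1\<close> are the radii at which a growing circle around
  the receiver first touches the boundary of the disk and last meets the disk.\<close>

lemma arccos_argument_bounds:
  fixes r0 R s :: real
  assumes r0: "r0 > 0" and R: "R \<ge> r0" and s: "s > 0"
  defines "c \<equiv> (r0\<^sup>2 * s\<^sup>2 + r0\<^sup>2 - R\<^sup>2) / (2 * r0\<^sup>2 * s)"
  shows "-1 \<le> c \<longleftrightarrow> (R - r0) / r0 \<le> s" and "c \<le> 1 \<longleftrightarrow> s \<le> (R + r0) / r0"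
proof -
  have "c \<ge> -1 \<longleftrightarrow> - (2 * r0\<^sup>2 * s) \<le> r0\<^sup>2 * s\<^sup>2 + r0\<^sup>2 - R\<^sup>2"
    unfolding c_def using r0 s by (simp add: pos_le_divide_eq)
  also have "\<dots> \<longleftrightarrow> R\<^sup>2 \<le> (r0 * s + r0)\<^sup>2"
    by (simp add: power2_eq_square algebra_simps)
  also have "\<dots> \<longleftrightarrow> R \<le> r0 * s + r0"
    using r0 R s by (intro abs_le_square_iff[of R, symmetric, THEN trans]) auto
  also have "\<dots> \<longleftrightarrow> (R - r0) / r0 \<le> s"
    using r0 by (auto simp: pos_divide_le_eq algebra_simps)
  finally show "-1 \<le> c \<longleftrightarrow> (R - r0) / r0 \<le> s" .
  have "c \<le> 1 \<longleftrightarrow> r0\<^sup>2 * s\<^sup>2 + r0\<^sup>2 - R\<^sup>2 \<le> 2 * r0\<^sup>2 * s"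
    unfolding c_def using r0 s by (simp add: pos_divide_le_eq)
  also have "\<dots> \<longleftrightarrow> (r0 * s - r0)\<^sup>2 \<le> R\<^sup>2"
    by (simp add: power2_eq_square algebra_simps)
  also have "\<dots> \<longleftrightarrow> \<bar>r0 * s - r0\<bar> \<le> R"
    using r0 R by (intro abs_le_square_iff[of _ R, symmetric, THEN trans]) auto
  also have "\<dots> \<longleftrightarrow> r0 * s - r0 \<le> R"
  proof -
    \<comment> \<open>The other half of the absolute value is automatic: r0 - r0 s < r0 \<le>
      R.\<close>
    have "r0 * s > 0" using r0 s by simp
    then show ?thesis using R by linarith
  qed
  also have "\<dots> \<longleftrightarrow> s \<le> (R + r0) / r0"
    using r0 by (auto simp: pos_le_divide_eq algebra_simps)
  finally show "c \<le> 1 \<longleftrightarrow> s \<le> (R + r0) / r0" .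
qed

lemma Psi_nonneg: "\<beta> > 0 \<Longrightarrow> 0 \<le> Psi \<alpha> \<beta> x"
  unfolding Psi_def set_lebesgue_integral_def
  by (intro integral_nonneg_AE) (auto intro!: divide_nonneg_pos add_pos_nonneg simp: indicator_def)

lemma calZ1_nonneg:
  assumes "\<beta> > 0" "r0 > 0" "R \<ge> r0"
  shows "0 \<le> calZ1 \<alpha> \<beta> R r0"
  unfolding calZ1_def set_lebesgue_integral_def
proof (intro integral_nonneg_AE AE_I2)
  fix s
  let ?c = "(r0\<^sup>2 * s\<^sup>2 + r0\<^sup>2 - R\<^sup>2) / (2 * r0\<^sup>2 * s)"
  show "0 \<le> indicator {(R - r0) / r0..(R + r0) / r0} s *\<^sub>R (s powr (\<alpha> + 1) / (\<beta> + s powr \<alpha>) * arccos ?c)"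
  proof (cases "s \<in> {(R - r0) / r0..(R + r0) / r0}")
    case True
    have "0 \<le> arccos ?c"
    \<comment> \<open>The value s = 0 is in range only for R = r0. Division by zero then makes the
      argument 0, and arccos 0 = pi / 2.\<close>
    proof (cases "s = 0")
      case False
      moreover have "0 \<le> (R - r0) / r0" using assms by simp
      ultimately have "s > 0" using True by auto
      from arccos_argument_bounds[OF assms(2,3) this] True show ?thesis
        by (intro arccos_lbound) auto
    qed simp
    then show ?thesis using assms(1)
      by (intro scaleR_nonneg_nonneg mult_nonneg_nonneg divide_nonneg_pos add_pos_nonneg) auto
  next
    case False
    then show ?thesis by (simp only: indicator_simps not_False_eq_True scaleR_zero_left order_refl)
  qed
qed

lemma nn_integral_disk_attenuation:
  assumes \<alpha>: "\<alpha> > 0" and \<beta>: "\<beta> > 0" and r0: "r0 > 0" and R: "R \<ge> r0"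
  shows "(\<integral>\<^sup>+z. ennreal (attenuation \<alpha> \<beta> (cmod (z - of_real r0 * cis \<theta>) / r0)) * indicator (cball 0 R) z \<partial>lborel) =
    ennreal (2 * r0\<^sup>2 * (pi / \<beta> * Psi \<alpha> \<beta> ((R - r0) / r0) + calZ1 \<alpha> \<beta> R r0))"
proof -
  define c where "c s = (r0\<^sup>2 * s\<^sup>2 + r0\<^sup>2 - R\<^sup>2) / (2 * r0\<^sup>2 * s)" for s
  define clip where "clip s = max (-1) (min 1 (c s))" for s
  define lo where "lo = (R - r0) / r0"
  define hi where "hi = (R + r0) / r0"
  have lo: "0 \<le> lo" "lo \<le> hi" using r0 R by (auto simp: lo_def hi_def divide_simps)
  have c_ge: "c s \<ge> -1 \<longleftrightarrow> s \<ge> lo" and c_le: "c s \<le> 1 \<longleftrightarrow> s \<le> hi" if "s > 0" for s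
    using arccos_argument_bounds[OF r0 R that] by (simp_all add: c_def lo_def hi_def)
  have clip: "clip s = c s" if "s \<in> {lo..hi}" for s
  proof (cases "s = 0")
    case True
    then show ?thesis by (simp add: clip_def c_def)
  next
    case False
    with that lo have "s > 0" by simp
    with c_ge[OF this] c_le[OF this] that show ?thesis by (simp add: clip_def)
  qed
  have clip_lo: "arccos (clip s) = pi" if "0 < s" "s < lo" for s
    using c_ge[OF that(1)] that by (simp add: clip_def)
  have clip_hi: "arccos (clip s) = 0" if "s > hi" for s
  proof -
    have "s > 0" using that lo by simp
    from c_le[OF this] that show ?thesis by (simp add: clip_def)
  qed
  have clipm[measurable]: "(\<lambda>s. arccos (clip s)) \<in> borel_measurable borel"
    unfolding clip_def c_def by measurable
  have clip_bd: "0 \<le> arccos (clip s)" "arccos (clip s) \<le> pi" for s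
    unfolding clip_def by (auto intro!: arccos_lbound arccos_ubound)
  let ?w = "\<lambda>s. s * attenuation \<alpha> \<beta> s"
  have w: "?w s = s powr (\<alpha> + 1) / (\<beta> + s powr \<alpha>)" if "s \<ge> 0" for s
    using that by (auto simp: attenuation_def powr_add)
  have w_bd: "0 \<le> ?w s" "?w s \<le> s" if "s \<ge> 0" for s
    using that attenuation_bounds[OF \<beta>] by (auto intro: mult_left_le)
  have "(\<integral>\<^sup>+z. ennreal (attenuation \<alpha> \<beta> (cmod (z - of_real r0 * cis \<theta>) / r0)) * indicator (cball 0 R) z \<partial>lborel) =
    ennreal (r0\<^sup>2) * (\<integral>\<^sup>+s. ennreal s * ennreal (attenuation \<alpha> \<beta> s) * ennreal (2 * arccos (clip s)) * indicator {0..} s \<partial>lborel)"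
    unfolding clip_def c_def by (rule nn_integral_disk_around) (use r0 R in measurable)
  also have "(\<integral>\<^sup>+s. ennreal s * ennreal (attenuation \<alpha> \<beta> s) * ennreal (2 * arccos (clip s)) * indicator {0..} s \<partial>lborel) =
     (\<integral>\<^sup>+s. ennreal (2 * pi * ?w s) * indicator {0..lo} s + ennreal (2 * (?w s * arccos (clip s))) * indicator {lo..hi} s \<partial>lborel)"
  proof (rule nn_integral_cong_AE)
    \<comment> \<open>At s = lo both indicators on the right are 1 and would count the point twice;
      the clipped arccos is identified only for s > 0.\<close>
    have "AE s in lborel. s \<noteq> (0::real)" "AE s in lborel. s \<noteq> lo" by (rule AE_lborel_singleton)+
    then show "AE s in lborel. ennreal s * ennreal (attenuation \<alpha> \<beta> s) * ennreal (2 * arccos (clip s)) * indicator {0..} s =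
       ennreal (2 * pi * ?w s) * indicator {0..lo} s + ennreal (2 * (?w s * arccos (clip s))) * indicator {lo..hi} s"
    proof eventually_elim
      case (elim s)
      have *: "ennreal s * ennreal (attenuation \<alpha> \<beta> s) * ennreal (2 * arccos (clip s)) = ennreal (2 * (?w s * arccos (clip s)))"
        if "s \<ge> 0"
        using that attenuation_bounds[OF \<beta>] clip_bd(1) by (simp add: ennreal_mult[symmetric] mult_ac)
      consider "s < 0" | "0 < s" "s < lo" | "lo < s" "s \<le> hi" | "s > hi" "s > lo" using elim lo by linarith
      then show ?case
      proof cases
        case 2
        then show ?thesis using * clip_lo[OF 2] by (simp add: mult_ac)
      next
        case 4
        then show ?thesis using * clip_hi[OF 4(1)] lo by simp
      qed (use * lo in \<open>auto simp: indicator_def\<close>)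
    qed
  qed
  also have "\<dots> = (\<integral>\<^sup>+s. ennreal (2 * pi * ?w s) * indicator {0..lo} s \<partial>lborel) +
       (\<integral>\<^sup>+s. ennreal (2 * (?w s * arccos (clip s))) * indicator {lo..hi} s \<partial>lborel)"
    by (rule nn_integral_add) auto
  also have "(\<integral>\<^sup>+s. ennreal (2 * pi * ?w s) * indicator {0..lo} s \<partial>lborel) = ennreal (LINT s:{0..lo}|lborel. 2 * pi * ?w s)"
  proof (rule nn_integral_set_bounded[where B = "2 * pi * lo"])
    fix s assume s: "s \<in> {0..lo}"
    then have "?w s \<le> lo" "0 \<le> ?w s" using w_bd[of s] by auto
    then show "0 \<le> 2 * pi * ?w s \<and> 2 * pi * ?w s \<le> 2 * pi * lo" by simp
  qed measurable
  also have "(LINT s:{0..lo}|lborel. 2 * pi * ?w s) = 2 * (pi / \<beta> * Psi \<alpha> \<beta> lo)"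
  proof -
    have "(LINT s:{0..lo}|lborel. 2 * pi * ?w s) = (LINT s:{0..lo}|lborel. 2 * pi / \<beta> * (s powr (\<alpha> + 1) / (1 + s powr \<alpha> * inverse \<beta>)))"
    proof (rule set_lebesgue_integral_cong)
      show "\<forall>s. s \<in> {0..lo} \<longrightarrow> 2 * pi * ?w s = 2 * pi / \<beta> * (s powr (\<alpha> + 1) / (1 + s powr \<alpha> * inverse \<beta>))"
      proof (intro allI impI)
        fix s assume "s \<in> {0..lo}"
        then have "?w s = s powr (\<alpha> + 1) / (\<beta> + s powr \<alpha>)" using w by simp
        \<comment> \<open>\<open>Psi\<close> is normalised with 1 + r^\<alpha> / \<beta> while
          \<open>calZ1\<close> keeps \<beta> + r^\<alpha>; this explains the extra 1 / \<beta> in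
          front of \<open>Psi\<close>.\<close>
        also have "\<beta> + s powr \<alpha> = \<beta> * (1 + s powr \<alpha> * inverse \<beta>)" using \<beta> by (simp add: field_simps)
        finally show "2 * pi * ?w s = 2 * pi / \<beta> * (s powr (\<alpha> + 1) / (1 + s powr \<alpha> * inverse \<beta>))" by simp
      qed
    qed simp
    also have "\<dots> = 2 * pi / \<beta> * Psi \<alpha> \<beta> lo"
      unfolding Psi_def by (rule set_integral_mult_right)
    finally show ?thesis by simp
  qed
  also have "(\<integral>\<^sup>+s. ennreal (2 * (?w s * arccos (clip s))) * indicator {lo..hi} s \<partial>lborel) =
     ennreal (LINT s:{lo..hi}|lborel. 2 * (?w s * arccos (clip s)))"
  proof (rule nn_integral_set_bounded[where B = "2 * (hi * pi)"])
    fix s assume s: "s \<in> {lo..hi}"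
    then have "0 \<le> ?w s" "?w s \<le> hi" using w_bd[of s] lo by auto
    have "?w s * arccos (clip s) \<le> hi * pi"
      by (rule mult_mono) (use \<open>?w s \<le> hi\<close> clip_bd[of s] lo in auto)
    moreover have "0 \<le> ?w s * arccos (clip s)"
      by (rule mult_nonneg_nonneg) (use \<open>0 \<le> ?w s\<close> clip_bd[of s] in auto)
    ultimately show "0 \<le> 2 * (?w s * arccos (clip s)) \<and> 2 * (?w s * arccos (clip s)) \<le> 2 * (hi * pi)"
      by linarith
  qed measurable
  also have "(LINT s:{lo..hi}|lborel. 2 * (?w s * arccos (clip s))) = 2 * calZ1 \<alpha> \<beta> R r0"
  proof -
    have "(LINT s:{lo..hi}|lborel. 2 * (?w s * arccos (clip s))) =
      (LINT s:{lo..hi}|lborel. 2 * (s powr (\<alpha> + 1) / (\<beta> + s powr \<alpha>) * arccos (c s)))"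
      by (rule set_lebesgue_integral_cong) (use w clip lo in auto)
    then show ?thesis
      unfolding calZ1_def c_def lo_def hi_def by (simp only: set_integral_mult_right)
  qed
  also have "ennreal (r0\<^sup>2) * (ennreal (2 * (pi / \<beta> * Psi \<alpha> \<beta> lo)) + ennreal (2 * calZ1 \<alpha> \<beta> R r0)) =
     ennreal (2 * r0\<^sup>2 * (pi / \<beta> * Psi \<alpha> \<beta> ((R - r0) / r0) + calZ1 \<alpha> \<beta> R r0))"
  proof -
    have "0 \<le> Psi \<alpha> \<beta> lo" "0 \<le> calZ1 \<alpha> \<beta> R r0"
      using Psi_nonneg[OF \<beta>] calZ1_nonneg[OF \<beta> r0 R] by auto
    then show ?thesis using \<beta>
      by (subst ennreal_plus[symmetric]) (auto simp: ennreal_mult[symmetric] algebra_simps lo_def)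
  qed
  finally show ?thesis .
qed

lemma emeasure_lborel_disk: "R \<ge> 0 \<Longrightarrow> emeasure lborel (cball (0::complex) R) = ennreal (pi * R\<^sup>2)"
  by (simp add: emeasure_cball unit_ball_vol_2)

lemma integral_uniform_disk:
  fixes F :: "complex \<Rightarrow> real"
  assumes [measurable]: "F \<in> borel_measurable borel" and "\<And>z. 0 \<le> F z" and R: "R > 0" and v: "v \<ge> 0"
    and eq: "(\<integral>\<^sup>+z. ennreal (F z) * indicator (cball 0 R) z \<partial>lborel) = ennreal v"
  shows "(LINT z|uniform_measure lborel (cball 0 R). F z) = v / (pi * R\<^sup>2)"
proof -
  have "(LINT z|uniform_measure lborel (cball 0 R). F z) =
      enn2real (\<integral>\<^sup>+z. ennreal (F z) \<partial>uniform_measure lborel (cball 0 R))"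
    by (rule integral_eq_nn_integral) (use assms in auto)
  also have "(\<integral>\<^sup>+z. ennreal (F z) \<partial>uniform_measure lborel (cball 0 R)) =
      (\<integral>\<^sup>+z. ennreal (F z) * indicator (cball 0 R) z \<partial>lborel) / emeasure lborel (cball (0::complex) R)"
    by (rule nn_integral_uniform_measure) auto
  also have "\<dots> = ennreal (v / (pi * R\<^sup>2))"
    unfolding eq using R v by (simp add: emeasure_lborel_disk divide_ennreal)
  finally show ?thesis using R v by simp
qed

text \<open>The sign matches \<^const>\<open>rpolar\<close>, which adds the receiver to the position instead of
  subtracting it.\<close>

lemma nn_integral_disk_polar:
  fixes G :: "complex \<Rightarrow> ennreal"
  assumes [measurable]: "G \<in> borel_measurable borel" and R: "R > 0"
  shows "(\<integral>\<^sup>+z. G z * indicator (cball 0 R) z \<partial>lborel) = ennreal (R\<^sup>2 / 2) *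
    (\<integral>\<^sup>+\<rho>. (\<integral>\<^sup>+\<phi>. G (- (of_real (R * sqrt \<rho>) * cis \<phi>)) * indicator {0..2 * pi} \<phi> \<partial>lborel) * indicator {0..1} \<rho> \<partial>lborel)"
proof -
  have cism[measurable]: "cis \<in> borel_measurable borel"
    by (intro borel_measurable_continuous_onI continuous_intros)
  have [measurable]: "Measurable.pred borel (\<lambda>z::complex. z \<in> cball 0 R)"
    by (simp add: pred_def)
  define H where "H r = (\<integral>\<^sup>+\<phi>. G (- (of_real r * cis \<phi>)) * indicator {0..2 * pi} \<phi> \<partial>lborel)" for r
  have [measurable]: "H \<in> borel_measurable borel" unfolding H_def by measurable
  \<comment> \<open>Beginning the angle at pi makes the shift back to [0, 2 pi) produce the minus
    sign.\<close>
  have inner: "(\<integral>\<^sup>+\<phi>. (G (of_real r * cis \<phi>) * indicator (cball 0 R) (of_real r * cis \<phi>)) * indicator {pi..<pi + 2 * pi} \<phi> \<partial>lborel)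
      = H r * indicator {..R} r" if "r \<ge> 0" for r
  proof -
    have "(\<integral>\<^sup>+\<phi>. (G (of_real r * cis \<phi>) * indicator (cball 0 R) (of_real r * cis \<phi>)) * indicator {pi..<pi + 2 * pi} \<phi> \<partial>lborel)
       = (\<integral>\<^sup>+\<phi>. (G (of_real r * cis \<phi>) * indicator {pi..<pi + 2 * pi} \<phi>) * indicator {..R} r \<partial>lborel)"
      using that by (intro nn_integral_cong) (auto simp: indicator_def norm_mult)
    also have "\<dots> = (\<integral>\<^sup>+\<phi>. G (of_real r * cis \<phi>) * indicator {pi..<pi + 2 * pi} \<phi> \<partial>lborel) * indicator {..R} r"
      by (rule nn_integral_multc) measurable
    also have "(\<integral>\<^sup>+\<phi>. G (of_real r * cis \<phi>) * indicator {pi..<pi + 2 * pi} \<phi> \<partial>lborel) =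
        (\<integral>\<^sup>+\<phi>. G (of_real r * cis (\<phi> + pi)) * indicator {0..<2 * pi} \<phi> \<partial>lborel)"
      using nn_integral_shift_indicator[of "\<lambda>\<phi>. G (of_real r * cis \<phi>)" pi 0 "2 * pi"]
      by (simp add: add.commute)
    also have "\<dots> = H r" unfolding H_def
    proof (rule nn_integral_cong_AE)
      have "AE \<phi> in lborel. \<phi> \<noteq> 2 * pi" by (rule AE_lborel_singleton)
      then show "AE \<phi> in lborel. G (of_real r * cis (\<phi> + pi)) * indicator {0..<2 * pi} \<phi> =
          G (- (of_real r * cis \<phi>)) * indicator {0..2 * pi} \<phi>"
        by eventually_elim (auto simp: indicator_def simp flip: cis_mult)
    qed
    finally show ?thesis .
  qed
  have "(\<integral>\<^sup>+z. G z * indicator (cball 0 R) z \<partial>lborel) =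
    (\<integral>\<^sup>+r. ennreal r * (\<integral>\<^sup>+\<phi>. (G (of_real r * cis \<phi>) * indicator (cball 0 R) (of_real r * cis \<phi>)) *
       indicator {pi..<pi + 2 * pi} \<phi> \<partial>lborel) * indicator {0..} r \<partial>lborel)"
    by (rule nn_integral_polar) measurable
  \<comment> \<open>For \<rho> = (r / R)^2 one has r dr = (R^2 / 2) d\<rho>: the squared relative
    radius of a uniform point of the disk is uniform on [0, 1].\<close>
  also have "\<dots> = (\<integral>\<^sup>+r. ennreal (R\<^sup>2 / 2) * (H (R * sqrt ((r / R)\<^sup>2)) * ennreal (2 * r / R\<^sup>2) * indicator {0..R} r) \<partial>lborel)"
  proof (intro nn_integral_cong)
    fix r :: real
    show "ennreal r * (\<integral>\<^sup>+\<phi>. (G (of_real r * cis \<phi>) * indicator (cball 0 R) (of_real r * cis \<phi>)) *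
       indicator {pi..<pi + 2 * pi} \<phi> \<partial>lborel) * indicator {0..} r =
      ennreal (R\<^sup>2 / 2) * (H (R * sqrt ((r / R)\<^sup>2)) * ennreal (2 * r / R\<^sup>2) * indicator {0..R} r)"
    proof (cases "0 \<le> r \<and> r \<le> R")
      case True
      then have "ennreal (R\<^sup>2 / 2) * (H (R * sqrt ((r / R)\<^sup>2)) * ennreal (2 * r / R\<^sup>2) * indicator {0..R} r)
         = (ennreal (R\<^sup>2 / 2) * ennreal (2 * r / R\<^sup>2)) * H r"
        using R by (simp add: mult_ac)
      also have "ennreal (R\<^sup>2 / 2) * ennreal (2 * r / R\<^sup>2) = ennreal r"
        using R True by (subst ennreal_mult[symmetric]) auto
      finally show ?thesis using True inner[of r] by simp
    next
      case False
      then show ?thesis using inner[of r] by (auto simp: indicator_def)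
    qed
  qed
  also have "\<dots> = ennreal (R\<^sup>2 / 2) * (\<integral>\<^sup>+r. H (R * sqrt ((r / R)\<^sup>2)) * ennreal (2 * r / R\<^sup>2) * indicator {0..R} r \<partial>lborel)"
    by (rule nn_integral_cmult) measurable
  also have "(\<integral>\<^sup>+r. H (R * sqrt ((r / R)\<^sup>2)) * ennreal (2 * r / R\<^sup>2) * indicator {0..R} r \<partial>lborel) =
     (\<integral>\<^sup>+\<rho>. H (R * sqrt \<rho>) * indicator {(0 / R)\<^sup>2..(R / R)\<^sup>2} \<rho> \<partial>lborel)"
  proof (rule nn_integral_substitution_aux[symmetric, where g = "\<lambda>r. (r / R)\<^sup>2" and f = "\<lambda>\<rho>. H (R * sqrt \<rho>)"])
    show "((\<lambda>r. (r / R)\<^sup>2) has_real_derivative 2 * r / R\<^sup>2) (at r)" for r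
      using R by (auto intro!: derivative_eq_intros simp: power2_eq_square)
    show "continuous_on {0..R} (\<lambda>r. 2 * r / R\<^sup>2)"
      using R by (intro continuous_intros) auto
  qed (use R in auto)
  finally show ?thesis using R by (simp add: H_def)
qed

text \<open>The integrand depends on two distances, so it is not constant on circles around one
  receiver. Polar coordinates around the centre of the disk are used instead, and the double
  integral remains. The factor R^2 / 2 times the 2 pi from \<open>calX\<close> gives the
  area.\<close>

lemma nn_integral_disk_attenuation_prod:
  assumes \<beta>: "\<beta> > 0" and r0: "r0 > 0" and R: "R \<ge> r0"
  shows "(\<integral>\<^sup>+z. ennreal (attenuation \<alpha> \<beta> (cmod (z - of_real r0) / r0) *
            attenuation \<alpha> \<beta> (cmod (z - of_real r0 * cis \<theta>) / r0)) * indicator (cball 0 R) z \<partial>lborel) =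
         ennreal (pi * R\<^sup>2 * calX \<alpha> \<beta> R r0 \<theta>)"
    and "calX \<alpha> \<beta> R r0 \<theta> \<ge> 0"
proof -
  have cism[measurable]: "cis \<in> borel_measurable borel"
    by (intro borel_measurable_continuous_onI continuous_intros)
  have Rp: "R > 0" using r0 R by simp
  define k where "k \<rho> \<phi> = attenuation \<alpha> \<beta> (rpolar R r0 \<rho> \<phi> 0) * attenuation \<alpha> \<beta> (rpolar R r0 \<rho> \<phi> \<theta>)" for \<rho> \<phi>
  have k_bd: "0 \<le> k \<rho> \<phi>" "k \<rho> \<phi> \<le> 1" for \<rho> \<phi>
    using attenuation_bounds[OF \<beta>] by (auto simp: k_def intro: mult_le_one)
  have rp: "rpolar R r0 \<rho> \<phi> \<psi> = cmod (of_real r0 * cis \<psi> + of_real (R * sqrt \<rho>) * cis \<phi>) / r0" for \<rho> \<phi> \<psi>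
    by (simp add: rpolar_def cis_conv_exp)
  have km[measurable]: "(\<lambda>p. k (fst p) (snd p)) \<in> borel_measurable (borel \<Otimes>\<^sub>M borel)"
    unfolding k_def rp by measurable
  have km1[measurable]: "k \<rho> \<in> borel_measurable borel" for \<rho>
    unfolding k_def rp by measurable
  define J where "J \<rho> = (LINT \<phi>:{0..2 * pi}|lborel. k \<rho> \<phi>)" for \<rho>
  have [measurable]: "J \<in> borel_measurable borel"
    unfolding J_def set_lebesgue_integral_def
    by (rule lborel.borel_measurable_lebesgue_integral) (simp add: case_prod_beta)
  have J: "(\<integral>\<^sup>+\<phi>. ennreal (k \<rho> \<phi>) * indicator {0..2 * pi} \<phi> \<partial>lborel) = ennreal (J \<rho>)" for \<rho>
    unfolding J_def by (rule nn_integral_set_bounded[where B = 1]) (use k_bd in auto)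
  have J0: "0 \<le> J \<rho>" for \<rho>
    unfolding J_def set_lebesgue_integral_def using k_bd by (intro integral_nonneg_AE) auto
  have J1: "J \<rho> \<le> 2 * pi" for \<rho>
  proof -
    have "ennreal (J \<rho>) \<le> (\<integral>\<^sup>+\<phi>. indicator {0..2 * pi} \<phi> \<partial>lborel)"
      unfolding J[symmetric] using k_bd by (intro nn_integral_mono) (auto simp: indicator_def)
    also have "\<dots> = ennreal (2 * pi)" by simp
    finally show ?thesis by simp
  qed
  have X: "calX \<alpha> \<beta> R r0 \<theta> = 1 / (2 * pi) * (LINT \<rho>:{0..1}|lborel. J \<rho>)"
    unfolding calX_def J_def k_def attenuation_def ..
  have "0 \<le> (LINT \<rho>:{0..1}|lborel. J \<rho>)"
    unfolding set_lebesgue_integral_def using J0 by (intro integral_nonneg_AE) auto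
  then show nonneg: "calX \<alpha> \<beta> R r0 \<theta> \<ge> 0" unfolding X by simp
  have "(\<integral>\<^sup>+z. ennreal (attenuation \<alpha> \<beta> (cmod (z - of_real r0) / r0) *
            attenuation \<alpha> \<beta> (cmod (z - of_real r0 * cis \<theta>) / r0)) * indicator (cball 0 R) z \<partial>lborel) =
      ennreal (R\<^sup>2 / 2) * (\<integral>\<^sup>+\<rho>. (\<integral>\<^sup>+\<phi>. ennreal (k \<rho> \<phi>) * indicator {0..2 * pi} \<phi> \<partial>lborel) * indicator {0..1} \<rho> \<partial>lborel)"
  proof (subst nn_integral_disk_polar[OF _ Rp])
    have "cmod (- w - v) = cmod (v + w)" for v w :: complex
      by (metis add.commute minus_add_distrib norm_minus_cancel uminus_add_conv_diff diff_conv_add_uminus)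
    then show "ennreal (R\<^sup>2 / 2) *
      (\<integral>\<^sup>+\<rho>. (\<integral>\<^sup>+\<phi>. ennreal (attenuation \<alpha> \<beta> (cmod (- (of_real (R * sqrt \<rho>) * cis \<phi>) - of_real r0) / r0) *
            attenuation \<alpha> \<beta> (cmod (- (of_real (R * sqrt \<rho>) * cis \<phi>) - of_real r0 * cis \<theta>) / r0)) *
            indicator {0..2 * pi} \<phi> \<partial>lborel) * indicator {0..1} \<rho> \<partial>lborel) =
      ennreal (R\<^sup>2 / 2) * (\<integral>\<^sup>+\<rho>. (\<integral>\<^sup>+\<phi>. ennreal (k \<rho> \<phi>) * indicator {0..2 * pi} \<phi> \<partial>lborel) * indicator {0..1} \<rho> \<partial>lborel)"
      unfolding k_def rp by simp
  qed measurable
  also have "\<dots> = ennreal (R\<^sup>2 / 2) * ennreal (LINT \<rho>:{0..1}|lborel. J \<rho>)"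
    unfolding J by (subst nn_integral_set_bounded[where B = "2 * pi"]) (use J0 J1 in auto)
  also have "(LINT \<rho>:{0..1}|lborel. J \<rho>) = 2 * pi * calX \<alpha> \<beta> R r0 \<theta>"
    unfolding X by simp
  also have "ennreal (R\<^sup>2 / 2) * ennreal (2 * pi * calX \<alpha> \<beta> R r0 \<theta>) = ennreal (pi * R\<^sup>2 * calX \<alpha> \<beta> R r0 \<theta>)"
    using nonneg by (subst ennreal_mult[symmetric]) (auto simp: mult_ac)
  finally show "(\<integral>\<^sup>+z. ennreal (attenuation \<alpha> \<beta> (cmod (z - of_real r0) / r0) *
            attenuation \<alpha> \<beta> (cmod (z - of_real r0 * cis \<theta>) / r0)) * indicator (cball 0 R) z \<partial>lborel) =
         ennreal (pi * R\<^sup>2 * calX \<alpha> \<beta> R r0 \<theta>)" .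
qed


section \<open>Conditional outage probabilities\<close>

text \<open>Freezing: the joint law is a product, so V may be averaged with the value of U held
  fixed. Both integrals are stated over the underlying space, so that the inner one can be computed
  by results on random variables.\<close>

lemma (in prob_space) nn_integral_indep_var:
  assumes ind: "indep_var S U T V" and f[measurable]: "f \<in> borel_measurable (S \<Otimes>\<^sub>M T)"
  shows "(\<integral>\<^sup>+\<omega>. f (U \<omega>, V \<omega>) \<partial>M) = (\<integral>\<^sup>+\<omega>'. (\<integral>\<^sup>+\<omega>. f (U \<omega>', V \<omega>) \<partial>M) \<partial>M)"
proof -
  have UV[measurable]: "random_variable S U" "random_variable T V"
    and eq: "distr M S U \<Otimes>\<^sub>M distr M T V = distr M (S \<Otimes>\<^sub>M T) (\<lambda>x. (U x, V x))"
    using ind unfolding indep_var_distribution_eq by auto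
  interpret V: prob_space "distr M T V" by (rule prob_space_distr) simp
  have "(\<integral>\<^sup>+\<omega>. f (U \<omega>, V \<omega>) \<partial>M) = (\<integral>\<^sup>+x. f x \<partial>(distr M S U \<Otimes>\<^sub>M distr M T V))"
    unfolding eq by (simp add: nn_integral_distr)
  also have "\<dots> = (\<integral>\<^sup>+u. \<integral>\<^sup>+v. f (u, v) \<partial>distr M T V \<partial>distr M S U)"
    by (intro V.nn_integral_fst[symmetric]) simp
  also have "\<dots> = (\<integral>\<^sup>+\<omega>'. \<integral>\<^sup>+v. f (U \<omega>', v) \<partial>distr M T V \<partial>M)"
    by (rule nn_integral_distr) (auto intro!: V.borel_measurable_nn_integral)
  also have "\<dots> = (\<integral>\<^sup>+\<omega>'. (\<integral>\<^sup>+\<omega>. f (U \<omega>', V \<omega>) \<partial>M) \<partial>M)"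
  proof (rule nn_integral_cong)
    fix \<omega>' assume "\<omega>' \<in> space M"
    then have "U \<omega>' \<in> space S" using measurable_space[OF UV(1)] by simp
    then show "(\<integral>\<^sup>+v. f (U \<omega>', v) \<partial>distr M T V) = (\<integral>\<^sup>+\<omega>. f (U \<omega>', V \<omega>) \<partial>M)"
      by (intro nn_integral_distr) auto
  qed
  finally show ?thesis .
qed

lemma (in prob_space) indep_var_of_indep_vars:
  assumes "indep_vars (\<lambda>_. borel) Y S" and "A \<inter> B = {}" "A \<subseteq> S" "B \<subseteq> S"
    and "u \<in> measurable (PiM A (\<lambda>_. borel)) N1" "v \<in> measurable (PiM B (\<lambda>_. borel)) N2"
  shows "indep_var N1 (\<lambda>\<omega>. u (\<lambda>i\<in>A. Y i \<omega>)) N2 (\<lambda>\<omega>. v (\<lambda>i\<in>B. Y i \<omega>))"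
  using indep_var_compose[OF indep_var_restrict[OF assms(1-4)] assms(5,6)] by (simp add: o_def)

text \<open>Freeze T and use the exponential tail. Nonnegativity of T is asked only almost surely,
  because T will be built from exponential variables.\<close>

lemma (in prob_space) prob_exponential_exceeds:
  assumes ind: "indep_var borel T borel G" and G: "distributed M lborel G (exponential_density 1)"
    and T: "AE \<omega> in M. 0 \<le> T \<omega>"
  shows "(\<integral>\<^sup>+\<omega>. indicator {\<omega>. T \<omega> < G \<omega>} \<omega> \<partial>M) = (\<integral>\<^sup>+\<omega>. ennreal (exp (- T \<omega>)) \<partial>M)"
proof -
  have [measurable]: "random_variable borel G"
    using ind by (rule indep_var_rv2)
  have "(\<integral>\<^sup>+\<omega>. indicator {\<omega>. T \<omega> < G \<omega>} \<omega> \<partial>M) =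
    (\<integral>\<^sup>+\<omega>. (\<lambda>p. indicator {p. fst p < snd p} p) (T \<omega>, G \<omega>) \<partial>M)"
    by (intro nn_integral_cong) (simp add: indicator_def)
  also have "\<dots> = (\<integral>\<^sup>+\<omega>'. (\<integral>\<^sup>+\<omega>. (\<lambda>p. indicator {p. fst p < snd p} p) (T \<omega>', G \<omega>) \<partial>M) \<partial>M)"
    by (rule nn_integral_indep_var[OF ind]) measurable
  also have "\<dots> = (\<integral>\<^sup>+\<omega>. ennreal (exp (- T \<omega>)) \<partial>M)"
  proof (rule nn_integral_cong_AE, use T in eventually_elim)
    case (elim \<omega>')
    have "(\<integral>\<^sup>+\<omega>. indicator {p. fst p < snd p} (T \<omega>', G \<omega>) \<partial>M) = (\<integral>\<^sup>+\<omega>. indicator {\<omega> \<in> space M. T \<omega>' < G \<omega>} \<omega> \<partial>M)"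
      by (intro nn_integral_cong) (simp add: indicator_def)
    also have "\<dots> = emeasure M {\<omega> \<in> space M. T \<omega>' < G \<omega>}"
      by (rule nn_integral_indicator) measurable
    also have "\<dots> = ennreal (exp (- T \<omega>'))"
      using exponential_distributedD_gt[OF G elim] by (simp add: emeasure_eq_measure)
    finally show ?case .
  qed
  finally show ?thesis .
qed

text \<open>Exponential tilting: exp (-x) exp (-b x) is 1 / (1 + b) times the exponential density of
  rate 1 + b, whose mass is 1.\<close>

lemma (in prob_space) laplace_exponential:
  assumes G: "distributed M lborel G (exponential_density 1)" and b: "b \<ge> 0"
  shows "(\<integral>\<^sup>+\<omega>. ennreal (exp (- (b * G \<omega>))) \<partial>M) = ennreal (1 / (1 + b))"
proof -
  interpret E: prob_space "density lborel (exponential_density (1 + b))"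
    by (rule prob_space_exponential_density) (use b in simp)
  have "(\<integral>\<^sup>+x. ennreal (exponential_density (1 + b) x) \<partial>lborel) = 1"
    using E.emeasure_space_1 by (simp add: emeasure_density)
  moreover have "(\<integral>\<^sup>+\<omega>. ennreal (exp (- (b * G \<omega>))) \<partial>M) =
     (\<integral>\<^sup>+x. ennreal (exponential_density 1 x) * ennreal (exp (- (b * x))) \<partial>lborel)"
    by (rule distributed_nn_integral[OF G, symmetric]) simp
  moreover have "(\<integral>\<^sup>+x. ennreal (exponential_density 1 x) * ennreal (exp (- (b * x))) \<partial>lborel) =
     (\<integral>\<^sup>+x. ennreal (1 / (1 + b)) * ennreal (exponential_density (1 + b) x) \<partial>lborel)"
  proof (rule nn_integral_cong)
    fix x :: real
    have "exp (- x) * exp (- (b * x)) = 1 / (1 + b) * ((1 + b) * exp (- x * (1 + b)))"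
      using b by (simp add: mult_exp_exp distrib_left mult.commute)
    then show "ennreal (exponential_density 1 x) * ennreal (exp (- (b * x))) =
        ennreal (1 / (1 + b)) * ennreal (exponential_density (1 + b) x)"
      using b by (simp add: exponential_density_def ennreal_mult[symmetric])
  qed
  ultimately show ?thesis by (simp add: nn_integral_cmult)
qed

lemma measurable_fun_component:
  assumes "s \<in> A" and "f \<in> measurable N L"
  shows "(\<lambda>q. f (q s)) \<in> measurable (PiM A (\<lambda>_. N)) L"
  by (rule measurable_compose[OF measurable_component_singleton[of s A "\<lambda>_. N", OF assms(1)] assms(2)])

lemma measurable_Re_component:
  "s \<in> A \<Longrightarrow> (\<lambda>q. Re (q s)) \<in> borel_measurable (PiM A (\<lambda>_. borel))"
  by (intro measurable_fun_component) simp_all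

lemma Re_of_bool: "Re (of_bool b) = of_bool b"
  by (cases b) simp_all

section \<open>The network model and its independent sources of randomness\<close>

locale interference_network = prob_space \<Omega>
  for \<Omega> :: "'w measure" +
  fixes M :: nat
    and g :: "nat \<Rightarrow> nat \<Rightarrow> 'w \<Rightarrow> real"
    and I :: "nat \<Rightarrow> 'w \<Rightarrow> bool"
    and X :: "nat \<Rightarrow> 'w \<Rightarrow> complex"
    and \<alpha> \<beta> SNR p r_out r0 \<theta> :: real
  assumes \<alpha>: "\<alpha> > 0" and \<beta>: "\<beta> > 0" and SNR: "SNR > 0"
    and p: "0 \<le> p" "p \<le> 1"
    and r0: "0 < r0" and r_out: "r0 \<le> r_out"
    and fading: "\<And>i j. i \<in> {0..M} \<Longrightarrow> j \<in> {1, 2} \<Longrightarrow>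
           distributed \<Omega> lborel (g i j) (exponential_density 1)"
    and access_meas: "\<And>i. i \<in> {1..M} \<Longrightarrow> I i \<in> measurable \<Omega> (count_space UNIV)"
    and access_distr: "\<And>i. i \<in> {1..M} \<Longrightarrow>
           distr \<Omega> (count_space UNIV) (I i) = measure_pmf (bernoulli_pmf p)"
    and position_meas: "\<And>i. i \<in> {1..M} \<Longrightarrow> X i \<in> borel_measurable \<Omega>"
    and position_distr: "\<And>i. i \<in> {1..M} \<Longrightarrow>
           distr \<Omega> lborel (X i) = uniform_measure lborel (region r_out)"
    and indep: "indep_sets (source_events \<Omega> g I X) (sources M)"
begin

text \<open>All sources are embedded into the complex numbers, so that \<^const>\<open>indep_vars\<close> and
  its product-measure lemmas become applicable.\<close>

definition source_var :: "source \<Rightarrow> 'w \<Rightarrow> complex" where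
  "source_var s \<omega> = (case s of
       Fading i j \<Rightarrow> of_real (g i j \<omega>) | Access i \<Rightarrow> of_bool (I i \<omega>) | Position i \<Rightarrow> X i \<omega>)"

lemma source_var_simps [simp]:
  "source_var (Fading i j) \<omega> = of_real (g i j \<omega>)"
  "source_var (Access i) \<omega> = of_bool (I i \<omega>)"
  "source_var (Position i) \<omega> = X i \<omega>"
  by (auto simp: source_var_def)

lemma fading_meas: "i \<in> {0..M} \<Longrightarrow> j \<in> {1, 2} \<Longrightarrow> g i j \<in> borel_measurable \<Omega>"
  using distributed_measurable[OF fading] by simp

text \<open>The embeddings into the complex numbers are measurable, so each embedded source
  generates at most its original \<sigma>-algebra, and independence passes to smaller
  families.\<close>

lemma indep_source_var: "indep_vars (\<lambda>_. borel) source_var (sources M)"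
  unfolding indep_vars_def2
proof
  have mb[measurable]: "(of_bool :: bool \<Rightarrow> complex) \<in> borel_measurable (count_space UNIV)" by simp
  have mr[measurable]: "complex_of_real \<in> borel_measurable borel" by simp
  show "\<forall>s\<in>sources M. random_variable borel (source_var s)"
  proof
    fix s assume "s \<in> sources M"
    then show "random_variable borel (source_var s)"
      unfolding source_var_def[abs_def] sources_def
      using fading_meas access_meas position_meas
      by (auto intro: measurable_compose[OF _ mb] measurable_compose[OF _ mr])
  qed
  have sub: "{(\<lambda>\<omega>. h (f \<omega>)) -` A \<inter> space \<Omega> |A. A \<in> sets borel} \<subseteq> sets (vimage_algebra (space \<Omega>) f N)"
    if "h \<in> borel_measurable N" "space N = UNIV" for f :: "'w \<Rightarrow> 'c" and h :: "'c \<Rightarrow> complex" and N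
  proof -
    have "(\<lambda>\<omega>. h (f \<omega>)) -` A \<inter> space \<Omega> \<in> sets (vimage_algebra (space \<Omega>) f N)" if A: "A \<in> sets borel" for A
    proof -
      have "h -` A \<in> sets N"
        using measurable_sets[OF \<open>h \<in> borel_measurable N\<close> A] \<open>space N = UNIV\<close> by simp
      then have "f -` (h -` A) \<inter> space \<Omega> \<in> sets (vimage_algebra (space \<Omega>) f N)"
        by (rule in_vimage_algebra)
      then show ?thesis by (simp add: vimage_def)
    qed
    then show ?thesis by blast
  qed
  show "indep_sets (\<lambda>s. {source_var s -` A \<inter> space \<Omega> |A. A \<in> sets borel}) (sources M)"
  proof (rule indep_sets_mono_sets[OF indep])
    fix s
    show "{source_var s -` A \<inter> space \<Omega> |A. A \<in> sets borel} \<subseteq> source_events \<Omega> g I X s"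
      using sub[of complex_of_real borel] sub[of of_bool "count_space UNIV"] sub[of "\<lambda>x. x" borel]
      by (cases s) (simp_all add: source_var_def[abs_def] source_events_def)
  qed
qed

text \<open>With the access variable frozen, a silent interferer contributes 1 and an active one the
  Laplace transform of its fading gain; the Bernoulli law mixes the two.\<close>

lemma nn_integral_access_fading:
  assumes i: "i \<in> {1..M}" and j: "j \<in> {1, 2}" and b: "b \<ge> 0"
  shows "(\<integral>\<^sup>+\<omega>. ennreal (exp (- (b * (of_bool (I i \<omega>) * g i j \<omega>)))) \<partial>\<Omega>) = ennreal (1 - p + p / (1 + b))"
proof -
  let ?A = "{Access i}" and ?B = "{Fading i j}"
  have "indep_var borel (\<lambda>\<omega>. (\<lambda>q. Re (q (Access i))) (\<lambda>s\<in>?A. source_var s \<omega>))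
     borel (\<lambda>\<omega>. (\<lambda>q. Re (q (Fading i j))) (\<lambda>s\<in>?B. source_var s \<omega>))"
    using i j
    by (intro indep_var_of_indep_vars[OF indep_source_var] measurable_Re_component)
       (auto simp: sources_def)
  then have ind: "indep_var borel (\<lambda>\<omega>. of_bool (I i \<omega>)) borel (g i j)"
    by (simp add: Re_of_bool)
  have "(\<integral>\<^sup>+\<omega>. ennreal (exp (- (b * (of_bool (I i \<omega>) * g i j \<omega>)))) \<partial>\<Omega>) =
     (\<integral>\<^sup>+\<omega>. (\<lambda>(u, v). ennreal (exp (- (b * (u * v))))) (of_bool (I i \<omega>), g i j \<omega>) \<partial>\<Omega>)"
    by simp
  also have "\<dots> = (\<integral>\<^sup>+\<omega>'. (\<integral>\<^sup>+\<omega>. (\<lambda>(u, v). ennreal (exp (- (b * (u * v))))) (of_bool (I i \<omega>'), g i j \<omega>) \<partial>\<Omega>) \<partial>\<Omega>)"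
    by (rule nn_integral_indep_var[OF ind]) measurable
  also have "\<dots> = (\<integral>\<^sup>+\<omega>'. (\<lambda>x. ennreal (if x then 1 / (1 + b) else 1)) (I i \<omega>') \<partial>\<Omega>)"
  proof (rule nn_integral_cong)
    fix \<omega>'
    show "(\<integral>\<^sup>+\<omega>. (\<lambda>(u, v). ennreal (exp (- (b * (u * v))))) (of_bool (I i \<omega>'), g i j \<omega>) \<partial>\<Omega>) =
       (\<lambda>x. ennreal (if x then 1 / (1 + b) else 1)) (I i \<omega>')"
      using laplace_exponential[OF fading[of i j] b] i j
      by (cases "I i \<omega>'") (auto simp: emeasure_space_1)
  qed
  also have "\<dots> = (\<integral>\<^sup>+x. ennreal (if x then 1 / (1 + b) else 1) \<partial>distr \<Omega> (count_space UNIV) (I i))"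
    by (rule nn_integral_distr[symmetric]) (use access_meas[OF i] in auto)
  also have "\<dots> = ennreal (1 - p + p / (1 + b))"
    unfolding access_distr[OF i] using p b
    by (simp add: nn_integral_bernoulli_pmf ennreal_mult[symmetric] ennreal_plus[symmetric] add.commute del: ennreal_plus)
  finally show ?thesis .
qed

lemma AE_fading_nonneg: "j \<in> {1, 2} \<Longrightarrow> AE \<omega> in \<Omega>. \<forall>i\<in>{1..M}. 0 \<le> g i j \<omega>"
proof (rule AE_finite_allI)
  fix i assume j: "j \<in> {1, 2}" and i: "i \<in> {1..M}"
  then have D: "distributed \<Omega> lborel (g i j) (exponential_density 1)" by (intro fading) auto
  have "prob {\<omega> \<in> space \<Omega>. 0 < g i j \<omega>} = 1"
    using exponential_distributedD_gt[OF D, of 0] by simp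
  then have "AE \<omega> in \<Omega>. 0 < g i j \<omega>"
    using fading_meas[of i j] i j by (subst (asm) prob_Collect_eq_1) auto
  then show "AE \<omega> in \<Omega>. 0 \<le> g i j \<omega>" by eventually_elim simp
qed simp

text \<open>The complement of the outage event with \<open>c i\<close> in place of the path loss
  \<open>r i j powr (-\<alpha>)\<close>, written without the division in \<^const>\<open>sinr\<close>.\<close>

definition success :: "nat \<Rightarrow> (nat \<Rightarrow> real) \<Rightarrow> 'w \<Rightarrow> bool" where
  "success j c \<omega> \<longleftrightarrow> \<beta> * (inverse SNR + (\<Sum>i=1..M. of_bool (I i \<omega>) * g i j \<omega> * c i)) < g 0 j \<omega>"

lemma success_probability:
  assumes j: "j \<in> {1, 2}" and c: "\<And>i. i \<in> {1..M} \<Longrightarrow> 0 \<le> c i"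
  shows "(\<integral>\<^sup>+\<omega>. indicator {\<omega>. success j c \<omega>} \<omega> \<partial>\<Omega>) =
     ennreal (exp (- \<beta> / SNR) * (\<Prod>i=1..M. 1 - p + p / (1 + \<beta> * c i)))"
proof -
  define T where "T \<omega> = \<beta> * (inverse SNR + (\<Sum>i=1..M. of_bool (I i \<omega>) * g i j \<omega> * c i))" for \<omega>
  \<comment> \<open>The threshold T uses the fading indices from 1 on, the useful signal only index
    0, so the two groups of sources are disjoint.\<close>
  let ?A = "Access ` {1..M} \<union> (\<lambda>i. Fading i j) ` {1..M}" and ?B = "{Fading 0 j}"
  have "indep_var borel (\<lambda>\<omega>. (\<lambda>q. \<beta> * (inverse SNR + (\<Sum>i=1..M. Re (q (Access i)) * Re (q (Fading i j)) * c i))) (\<lambda>s\<in>?A. source_var s \<omega>))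
     borel (\<lambda>\<omega>. (\<lambda>q. Re (q (Fading 0 j))) (\<lambda>s\<in>?B. source_var s \<omega>))"
  proof (intro indep_var_of_indep_vars[OF indep_source_var])
    show "(\<lambda>q. \<beta> * (inverse SNR + (\<Sum>i=1..M. Re (q (Access i)) * Re (q (Fading i j)) * c i)))
        \<in> borel_measurable (PiM ?A (\<lambda>_. borel))"
      by (intro borel_measurable_times borel_measurable_add borel_measurable_const borel_measurable_sum
            measurable_Re_component) auto
    show "(\<lambda>q. Re (q (Fading 0 j))) \<in> borel_measurable (PiM ?B (\<lambda>_. borel))"
      by (intro measurable_Re_component) auto
  qed (use j in \<open>auto simp: sources_def\<close>)
  moreover have "(\<lambda>\<omega>. (\<lambda>q. \<beta> * (inverse SNR + (\<Sum>i=1..M. Re (q (Access i)) * Re (q (Fading i j)) * c i))) (\<lambda>s\<in>?A. source_var s \<omega>)) = T"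
    by (auto simp: T_def fun_eq_iff Re_of_bool intro!: sum.cong)
  ultimately have ind: "indep_var borel T borel (g 0 j)" by simp
  have T: "AE \<omega> in \<Omega>. 0 \<le> T \<omega>"
    using AE_fading_nonneg[OF j]
    by eventually_elim (use \<beta> SNR c in \<open>auto simp: T_def intro!: mult_nonneg_nonneg add_nonneg_nonneg sum_nonneg\<close>)
  have "(\<integral>\<^sup>+\<omega>. indicator {\<omega>. success j c \<omega>} \<omega> \<partial>\<Omega>) = (\<integral>\<^sup>+\<omega>. ennreal (exp (- T \<omega>)) \<partial>\<Omega>)"
    unfolding success_def T_def[symmetric]
    by (rule prob_exponential_exceeds[OF ind _ T]) (use fading j in auto)
  also have "\<dots> = (\<integral>\<^sup>+\<omega>. ennreal (exp (- \<beta> / SNR)) * (\<Prod>i=1..M. ennreal (exp (- (\<beta> * c i * (of_bool (I i \<omega>) * g i j \<omega>))))) \<partial>\<Omega>)"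
  proof (rule nn_integral_cong)
    fix \<omega>
    have "exp (- T \<omega>) = exp (- \<beta> / SNR + (\<Sum>i=1..M. - (\<beta> * c i * (of_bool (I i \<omega>) * g i j \<omega>))))"
      unfolding T_def by (simp add: sum_negf sum_distrib_left algebra_simps divide_inverse)
    also have "\<dots> = exp (- \<beta> / SNR) * (\<Prod>i=1..M. exp (- (\<beta> * c i * (of_bool (I i \<omega>) * g i j \<omega>))))"
      by (simp only: exp_add exp_sum finite_atLeastAtMost)
    finally show "ennreal (exp (- T \<omega>)) = ennreal (exp (- \<beta> / SNR)) *
        (\<Prod>i=1..M. ennreal (exp (- (\<beta> * c i * (of_bool (I i \<omega>) * g i j \<omega>)))))"
      by (simp add: ennreal_mult prod_ennreal prod_nonneg)
  qed
  also have "\<dots> = ennreal (exp (- \<beta> / SNR)) *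
      (\<integral>\<^sup>+\<omega>. (\<Prod>i=1..M. ennreal (exp (- (\<beta> * c i * (of_bool (I i \<omega>) * g i j \<omega>))))) \<partial>\<Omega>)"
  proof (rule nn_integral_cmult)
    have [measurable]: "I i \<in> measurable \<Omega> (count_space UNIV)" "g i j \<in> borel_measurable \<Omega>" if "i \<in> {1..M}" for i
      using that j by (auto intro!: access_meas fading_meas)
    show "(\<lambda>\<omega>. \<Prod>i=1..M. ennreal (exp (- (\<beta> * c i * (of_bool (I i \<omega>) * g i j \<omega>))))) \<in> borel_measurable \<Omega>"
      by (intro borel_measurable_prod_ennreal) measurable
  qed
  also have "(\<integral>\<^sup>+\<omega>. (\<Prod>i=1..M. ennreal (exp (- (\<beta> * c i * (of_bool (I i \<omega>) * g i j \<omega>))))) \<partial>\<Omega>) =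
     (\<Prod>i=1..M. \<integral>\<^sup>+\<omega>. ennreal (exp (- (\<beta> * c i * (of_bool (I i \<omega>) * g i j \<omega>)))) \<partial>\<Omega>)"
  proof (rule indep_vars_nn_integral)
    \<comment> \<open>One block of sources per interferer; the blocks are disjoint, so the
      exponential factors are independent.\<close>
    let ?K = "\<lambda>i. {Access i, Fading i j}"
    have "indep_vars (\<lambda>i. PiM (?K i) (\<lambda>_. borel)) (\<lambda>i \<omega>. restrict (\<lambda>s. source_var s \<omega>) (?K i)) {1..M}"
      by (rule indep_vars_restrict[OF indep_source_var]) (use j in \<open>auto simp: sources_def disjoint_family_on_def\<close>)
    then have "indep_vars (\<lambda>_. borel) (\<lambda>i \<omega>. (\<lambda>i q. ennreal (exp (- (\<beta> * c i * (Re (q (Access i)) * Re (q (Fading i j))))))) i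
        (restrict (\<lambda>s. source_var s \<omega>) (?K i))) {1..M}"
    proof (rule indep_vars_compose2)
      fix i
      have [measurable]: "(\<lambda>q. Re (q (Access i))) \<in> borel_measurable (PiM (?K i) (\<lambda>_. borel))"
         "(\<lambda>q. Re (q (Fading i j))) \<in> borel_measurable (PiM (?K i) (\<lambda>_. borel))"
        by (rule measurable_Re_component; simp)+
      show "(\<lambda>q. ennreal (exp (- (\<beta> * c i * (Re (q (Access i)) * Re (q (Fading i j)))))))
          \<in> borel_measurable (PiM (?K i) (\<lambda>_. borel))"
        by measurable
    qed
    then show "indep_vars (\<lambda>_. borel) (\<lambda>i \<omega>. ennreal (exp (- (\<beta> * c i * (of_bool (I i \<omega>) * g i j \<omega>))))) {1..M}"
      by (simp add: Re_of_bool)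
  qed auto
  also have "\<dots> = (\<Prod>i=1..M. ennreal (1 - p + p / (1 + \<beta> * c i)))"
    by (intro prod.cong refl nn_integral_access_fading) (use j \<beta> c in auto)
  also have "\<dots> = ennreal (\<Prod>i=1..M. 1 - p + p / (1 + \<beta> * c i))"
    by (rule prod_ennreal) (use p \<beta> c in \<open>auto intro!: add_nonneg_nonneg divide_nonneg_nonneg\<close>)
  finally show ?thesis
    by (simp add: ennreal_mult')
qed

definition norm_dist :: "nat \<Rightarrow> complex \<Rightarrow> real" where
  "norm_dist j z = cmod (z - receiver r0 \<theta> j) / r0"

lemma norm_dist_measurable [measurable]: "norm_dist j \<in> borel_measurable borel"
  unfolding norm_dist_def[abs_def] by measurable

text \<open>The success factor of one interferer at normalized distance \<open>d\<close>.  It agrees with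
  \<open>1 - p + p * attenuation \<alpha> \<beta> d\<close> except at \<open>d = 0\<close>, where
  \<open>0 powr (-\<alpha>) = 0\<close> makes the interference vanish.\<close>

definition factor :: "real \<Rightarrow> real" where
  "factor d = 1 - p + p / (1 + \<beta> * d powr (-\<alpha>))"

lemma factor_measurable [measurable]: "factor \<in> borel_measurable borel"
  unfolding factor_def[abs_def] by measurable

lemma factor_bounds: "0 \<le> factor d" "factor d \<le> 1"
proof -
  have x: "0 \<le> \<beta> * d powr (-\<alpha>)" using \<beta> by simp
  have "p / (1 + \<beta> * d powr (-\<alpha>)) \<le> p / 1"
    by (rule divide_left_mono) (use x p in auto)
  moreover have "0 \<le> p / (1 + \<beta> * d powr (-\<alpha>))"
    using x p by (intro divide_nonneg_nonneg add_nonneg_nonneg) auto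
  ultimately show "0 \<le> factor d" "factor d \<le> 1" using p unfolding factor_def by auto
qed

lemma factor_eq_attenuation: "d > 0 \<Longrightarrow> factor d = 1 - p + p * attenuation \<alpha> \<beta> d"
proof -
  assume "d > 0"
  then have "1 + \<beta> * d powr (-\<alpha>) = (\<beta> + d powr \<alpha>) / d powr \<alpha>"
    by (simp add: powr_minus field_simps)
  then show ?thesis by (simp add: factor_def attenuation_def)
qed

section \<open>The conditional outage probability as a function of the distances\<close>

definition success_prob :: "(nat \<Rightarrow> real) \<Rightarrow> real" where
  "success_prob d = exp (- \<beta> / SNR) * (\<Prod>i=1..M. factor (d i))"

lemma success_prob_bounds: "0 \<le> success_prob d" "success_prob d \<le> 1"
proof -
  have "(\<Prod>i=1..M. factor (d i)) \<le> 1" "0 \<le> (\<Prod>i=1..M. factor (d i))"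
    using factor_bounds by (auto intro!: prod_le_1 prod_nonneg)
  moreover have "exp (- \<beta> / SNR) \<le> 1" using \<beta> SNR by simp
  ultimately show "0 \<le> success_prob d" "success_prob d \<le> 1"
    unfolding success_prob_def by (auto intro: mult_le_one)
qed

text \<open>Multiplying out the quotient in \<open>sinr\<close> needs a positive denominator, which
  is guaranteed where the fading gains of the interferers are nonnegative, hence almost
  surely.\<close>

lemma sinr_le_iff_not_success:
  assumes j: "j \<in> {1, 2}"
  shows "AE \<omega> in \<Omega>. sinr \<alpha> SNR M (\<lambda>i j. g i j \<omega>) (\<lambda>i. I i \<omega>) (ndist r0 \<theta> (\<lambda>i. X i \<omega>)) j \<le> \<beta> \<longleftrightarrow>
     \<not> success j (\<lambda>i. norm_dist j (X i \<omega>) powr (-\<alpha>)) \<omega>"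
  using AE_fading_nonneg[OF j]
proof eventually_elim
  case (elim \<omega>)
  have "0 < inverse SNR + (\<Sum>i=1..M. of_bool (I i \<omega>) * g i j \<omega> * norm_dist j (X i \<omega>) powr (-\<alpha>))"
    using SNR elim by (intro add_pos_nonneg sum_nonneg) auto
  then show ?case
    by (simp add: sinr_def success_def ndist_def norm_dist_def pos_divide_le_eq not_less)
qed

lemma success_measurable [measurable]:
  assumes "j \<in> {1, 2}" and [measurable]: "\<And>i. i \<in> {1..M} \<Longrightarrow> c i \<in> borel_measurable \<Omega>"
  shows "Measurable.pred \<Omega> (\<lambda>\<omega>. success j (\<lambda>i. c i \<omega>) \<omega>)"
proof -
  have [measurable]: "I i \<in> measurable \<Omega> (count_space UNIV)" "g i j \<in> borel_measurable \<Omega>" if "i \<in> {1..M}" for i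
    using that assms by (auto intro!: access_meas fading_meas)
  have [measurable]: "g 0 j \<in> borel_measurable \<Omega>" using assms by (auto intro!: fading_meas)
  have "(\<lambda>\<omega>. \<beta> * (inverse SNR + (\<Sum>i=1..M. of_bool (I i \<omega>) * g i j \<omega> * c i \<omega>))) \<in> borel_measurable \<Omega>"
    by (intro borel_measurable_times borel_measurable_add borel_measurable_const borel_measurable_sum) measurable
  then show ?thesis unfolding success_def by measurable
qed

text \<open>\<open>k\<close> is an arbitrary weight that depends on the positions only. Taking the
  indicator of an event in the distance algebra yields the defining property of a conditional
  expectation.\<close>

lemma nn_integral_success:
  assumes j: "j \<in> {1, 2}"
    and k: "k \<in> borel_measurable (PiM (Position ` {1..M}) (\<lambda>_. borel))"
  shows "(\<integral>\<^sup>+\<omega>. k (\<lambda>s\<in>Position ` {1..M}. source_var s \<omega>) *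
            indicator {\<omega>. success j (\<lambda>i. norm_dist j (X i \<omega>) powr (-\<alpha>)) \<omega>} \<omega> \<partial>\<Omega>) =
         (\<integral>\<^sup>+\<omega>. k (\<lambda>s\<in>Position ` {1..M}. source_var s \<omega>) *
            ennreal (success_prob (\<lambda>i. norm_dist j (X i \<omega>))) \<partial>\<Omega>)"
proof -
  let ?P = "Position ` {1..M}"
  \<comment> \<open>Here the index set starts at 0, since the useful signal is averaged together
    with the interference.\<close>
  let ?Q = "Access ` {1..M} \<union> (\<lambda>i. Fading i j) ` {0..M}"
  let ?S = "PiM ?P (\<lambda>_. borel :: complex measure)" and ?T = "PiM ?Q (\<lambda>_. borel :: complex measure)"
  let ?U = "\<lambda>\<omega>. \<lambda>s\<in>?P. source_var s \<omega>" and ?V = "\<lambda>\<omega>. \<lambda>s\<in>?Q. source_var s \<omega>"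
  have ind: "indep_var ?S ?U ?T ?V"
    by (rule indep_var_restrict[OF indep_source_var]) (use j in \<open>auto simp: sources_def\<close>)
  let ?E = "\<lambda>p. \<beta> * (inverse SNR + (\<Sum>i=1..M. Re (snd p (Access i)) * Re (snd p (Fading i j)) *
      norm_dist j (fst p (Position i)) powr (-\<alpha>))) < Re (snd p (Fading 0 j))"
  define f :: "_ \<Rightarrow> ennreal" where "f p = k (fst p) * indicator {p. ?E p} p" for p
  have q[measurable]: "(\<lambda>p. Re (snd p s)) \<in> borel_measurable (?S \<Otimes>\<^sub>M ?T)" if "s \<in> ?Q" for s
    by (rule measurable_compose[OF measurable_snd measurable_Re_component[OF that]])
  have v[measurable]: "(\<lambda>p. norm_dist j (fst p (Position i))) \<in> borel_measurable (?S \<Otimes>\<^sub>M ?T)" if "i \<in> {1..M}" for i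
  proof -
    have "(\<lambda>v. v (Position i)) \<in> borel_measurable ?S"
      using that by (intro measurable_component_singleton) auto
    then show ?thesis
      by (intro measurable_compose[OF measurable_compose[OF measurable_fst] norm_dist_measurable])
  qed
  have "(\<lambda>p. \<beta> * (inverse SNR + (\<Sum>i=1..M. Re (snd p (Access i)) * Re (snd p (Fading i j)) *
      norm_dist j (fst p (Position i)) powr (-\<alpha>)))) \<in> borel_measurable (?S \<Otimes>\<^sub>M ?T)"
    by (intro borel_measurable_times borel_measurable_add borel_measurable_const borel_measurable_sum
          q measurable_compose[OF v, of _ "\<lambda>d. d powr (-\<alpha>)"]) auto
  moreover have "(\<lambda>p. Re (snd p (Fading 0 j))) \<in> borel_measurable (?S \<Otimes>\<^sub>M ?T)"
    by (rule q) simp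
  ultimately have "Measurable.pred (?S \<Otimes>\<^sub>M ?T) ?E" by measurable
  then have f: "f \<in> borel_measurable (?S \<Otimes>\<^sub>M ?T)"
    unfolding f_def using k by (intro borel_measurable_times_ennreal borel_measurable_indicator'
        measurable_compose[OF measurable_fst k]) auto
  have fUV: "f (?U \<omega>', ?V \<omega>) = k (?U \<omega>') * indicator {\<omega>. success j (\<lambda>i. norm_dist j (X i \<omega>') powr (-\<alpha>)) \<omega>} \<omega>" for \<omega> \<omega>'
  proof -
    have "?E (?U \<omega>', ?V \<omega>) \<longleftrightarrow> success j (\<lambda>i. norm_dist j (X i \<omega>') powr (-\<alpha>)) \<omega>"
      unfolding success_def by (simp add: Re_of_bool image_iff)
    then show ?thesis unfolding f_def by (simp add: indicator_def)
  qed
  have "(\<integral>\<^sup>+\<omega>. k (?U \<omega>) * indicator {\<omega>. success j (\<lambda>i. norm_dist j (X i \<omega>) powr (-\<alpha>)) \<omega>} \<omega> \<partial>\<Omega>)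
     = (\<integral>\<^sup>+\<omega>. f (?U \<omega>, ?V \<omega>) \<partial>\<Omega>)"
    unfolding fUV by (simp add: indicator_def)
  also have "\<dots> = (\<integral>\<^sup>+\<omega>'. (\<integral>\<^sup>+\<omega>. f (?U \<omega>', ?V \<omega>) \<partial>\<Omega>) \<partial>\<Omega>)"
    by (rule nn_integral_indep_var[OF ind f])
  also have "\<dots> = (\<integral>\<^sup>+\<omega>'. k (?U \<omega>') * ennreal (success_prob (\<lambda>i. norm_dist j (X i \<omega>'))) \<partial>\<Omega>)"
  proof (rule nn_integral_cong)
    fix \<omega>'
    have "(\<integral>\<^sup>+\<omega>. f (?U \<omega>', ?V \<omega>) \<partial>\<Omega>) =
        k (?U \<omega>') * (\<integral>\<^sup>+\<omega>. indicator {\<omega>. success j (\<lambda>i. norm_dist j (X i \<omega>') powr (-\<alpha>)) \<omega>} \<omega> \<partial>\<Omega>)"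
      unfolding fUV using success_measurable[OF j, of "\<lambda>i \<omega>. norm_dist j (X i \<omega>') powr (-\<alpha>)"]
      by (intro nn_integral_cmult borel_measurable_indicator') auto
    also have "\<dots> = k (?U \<omega>') * ennreal (success_prob (\<lambda>i. norm_dist j (X i \<omega>')))"
      by (subst success_probability[OF j]) (auto simp: success_prob_def factor_def)
    finally show "(\<integral>\<^sup>+\<omega>. f (?U \<omega>', ?V \<omega>) \<partial>\<Omega>) = k (?U \<omega>') * ennreal (success_prob (\<lambda>i. norm_dist j (X i \<omega>')))" .
  qed
  finally show ?thesis .
qed

lemma position_fun_measurable [measurable]:
  "h \<in> borel_measurable borel \<Longrightarrow> i \<in> {1..M} \<Longrightarrow> (\<lambda>\<omega>. h (X i \<omega>)) \<in> borel_measurable \<Omega>"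
  using position_meas by (rule measurable_compose)

lemma success_prob_measurable: "(\<lambda>\<omega>. success_prob (\<lambda>i. norm_dist j (X i \<omega>))) \<in> borel_measurable \<Omega>"
  unfolding success_prob_def
  by (intro borel_measurable_times borel_measurable_const borel_measurable_prod
      position_fun_measurable[of "\<lambda>z. factor (norm_dist j z)"]) auto

lemma ndist_eq: "ndist r0 \<theta> (\<lambda>i. X i \<omega>) i j = norm_dist j (X i \<omega>)"
  by (simp add: ndist_def norm_dist_def)

text \<open>A conditional expectation is characterised by its integrals over the events of the
  conditioning algebra. Each such event is determined by the distances, hence by the positions, so
  the weighted identity \<open>nn_integral_success\<close> applies.\<close>

lemma cond_outage_eq:
  assumes j: "j \<in> {1, 2}"
  shows "AE \<omega> in \<Omega>. cond_outage \<Omega> \<alpha> \<beta> SNR r0 \<theta> M g I X j \<omega> = 1 - success_prob (\<lambda>i. norm_dist j (X i \<omega>))"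
proof -
  let ?N = "PiM ({1..M} \<times> {1, 2}) (\<lambda>_. borel :: real measure)"
  let ?F = "dist_algebra \<Omega> r0 \<theta> M X"
  let ?O = "{\<omega> \<in> space \<Omega>. sinr \<alpha> SNR M (\<lambda>i j. g i j \<omega>) (\<lambda>i. I i \<omega>) (ndist r0 \<theta> (\<lambda>i. X i \<omega>)) j \<le> \<beta>}"
  let ?s = "\<lambda>\<omega>. success_prob (\<lambda>i. norm_dist j (X i \<omega>))"
  let ?S = "\<lambda>\<omega>. success j (\<lambda>i. norm_dist j (X i \<omega>) powr (-\<alpha>)) \<omega>"
  let ?P = "Position ` {1..M}"
  define R where "R \<omega> = (\<lambda>(i, j)\<in>{1..M} \<times> {1, 2}. ndist r0 \<theta> (\<lambda>i. X i \<omega>) i j)" for \<omega>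
  have R_app: "R \<omega> (i, l) = norm_dist l (X i \<omega>)" if "i \<in> {1..M}" "l \<in> {1, 2}" for i l \<omega>
    using that by (simp add: R_def ndist_eq)
  have R_meas: "R \<in> measurable \<Omega> ?N"
    unfolding R_def[abs_def] case_prod_beta ndist_eq
    by (intro measurable_restrict position_fun_measurable) auto
  have F: "?F = vimage_algebra (space \<Omega>) R ?N"
    by (simp add: dist_algebra_def R_def[abs_def])
  have RF: "R \<in> measurable ?F ?N"
    unfolding F using measurable_space[OF R_meas] by (intro measurable_vimage_algebra1) auto
  have sets_F: "sets ?F = {R -` A \<inter> space \<Omega> | A. A \<in> sets ?N}"
    unfolding F using measurable_space[OF R_meas] by (intro sets_vimage_algebra2) auto
  have sub: "subalgebra \<Omega> ?F"
    unfolding subalgebra_def sets_F using measurable_sets[OF R_meas] by (auto simp: F)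
  interpret finite_measure_subalgebra \<Omega> ?F
    by unfold_locales (rule sub)
  have s_meas[measurable]: "?s \<in> borel_measurable \<Omega>" by (rule success_prob_measurable)
  have S_meas[measurable]: "Measurable.pred \<Omega> ?S"
    using j by (intro success_measurable[of j "\<lambda>i \<omega>. norm_dist j (X i \<omega>) powr (-\<alpha>)"]
       position_fun_measurable[of "\<lambda>z. norm_dist j z powr (-\<alpha>)"]) auto
  have O_meas: "?O \<in> sets \<Omega>"
  proof -
    have [measurable]: "I i \<in> measurable \<Omega> (count_space UNIV)" "g i j \<in> borel_measurable \<Omega>" if "i \<in> {1..M}" for i
      using that j by (auto intro!: access_meas fading_meas)
    have [measurable]: "g 0 j \<in> borel_measurable \<Omega>" using j by (auto intro!: fading_meas)
    have "(\<lambda>\<omega>. \<Sum>i=1..M. of_bool (I i \<omega>) * g i j \<omega> * norm_dist j (X i \<omega>) powr (-\<alpha>)) \<in> borel_measurable \<Omega>"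
      by (intro borel_measurable_sum borel_measurable_times
          position_fun_measurable[of "\<lambda>z. norm_dist j z powr (-\<alpha>)"]) measurable
    then show ?thesis unfolding sinr_def ndist_eq by measurable
  qed
  have "AE \<omega> in \<Omega>. real_cond_exp \<Omega> ?F (indicator ?O) \<omega> = 1 - ?s \<omega>"
  proof (rule real_cond_exp_charact)
    fix A assume "A \<in> sets ?F"
    then obtain C where C: "C \<in> sets ?N" "A = R -` C \<inter> space \<Omega>" unfolding sets_F by auto
    have A[measurable]: "A \<in> sets \<Omega>" using C measurable_sets[OF R_meas] by simp
    \<comment> \<open>The event A, the preimage of C under the distance vector, rewritten as a
      function of the embedded positions.\<close>
    define k :: "_ \<Rightarrow> ennreal" where
      "k v = indicator C (\<lambda>(i, l)\<in>{1..M} \<times> {1, 2}. norm_dist l (v (Position i)))" for v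
    have "(\<lambda>v. \<lambda>p\<in>{1..M} \<times> {1, 2}. norm_dist (snd p) (v (Position (fst p))))
       \<in> measurable (PiM ?P (\<lambda>_. borel)) ?N"
      by (intro measurable_restrict measurable_fun_component norm_dist_measurable) auto
    then have k: "k \<in> borel_measurable (PiM ?P (\<lambda>_. borel))"
      unfolding k_def case_prod_beta using C(1) by (intro measurable_compose[OF _ borel_measurable_indicator])
    have kA: "k (\<lambda>s\<in>?P. source_var s \<omega>) = indicator A \<omega>" if "\<omega> \<in> space \<Omega>" for \<omega>
    proof -
      have "(\<lambda>(i, l)\<in>{1..M} \<times> {1, 2}. norm_dist l ((\<lambda>s\<in>?P. source_var s \<omega>) (Position i))) = R \<omega>"
        unfolding R_def ndist_eq by (auto simp: fun_eq_iff restrict_def)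
      then show ?thesis using that unfolding k_def C(2) by (simp add: indicator_def)
    qed
    have "(\<integral>\<^sup>+\<omega>. indicator A \<omega> * indicator {\<omega>. ?S \<omega>} \<omega> \<partial>\<Omega>) = (\<integral>\<^sup>+\<omega>. indicator A \<omega> * ennreal (?s \<omega>) \<partial>\<Omega>)"
      using nn_integral_success[OF j k] kA by (simp cong: nn_integral_cong)
    then have "(\<integral>\<^sup>+\<omega>. ennreal (indicator A \<omega> * indicator {\<omega>. ?S \<omega>} \<omega>) \<partial>\<Omega>) = (\<integral>\<^sup>+\<omega>. ennreal (indicator A \<omega> * ?s \<omega>) \<partial>\<Omega>)"
      using success_prob_bounds by (simp add: ennreal_mult ennreal_indicator)
    then have eq: "(\<integral>\<omega>. indicator A \<omega> * indicator {\<omega>. ?S \<omega>} \<omega> \<partial>\<Omega>) = (\<integral>\<omega>. indicator A \<omega> * ?s \<omega> \<partial>\<Omega>)"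
      using success_prob_bounds by (simp add: integral_eq_nn_integral)
    have int1: "integrable \<Omega> (\<lambda>\<omega>. indicator A \<omega> * indicator {\<omega>. ?S \<omega>} \<omega> :: real)"
      by (rule integrable_const_bound[where B = 1]) (auto simp: indicator_def)
    have int2: "integrable \<Omega> (\<lambda>\<omega>. indicator A \<omega> * ?s \<omega>)"
      by (rule integrable_const_bound[where B = 1]) (use success_prob_bounds in \<open>auto simp: indicator_def\<close>)
    have int3: "integrable \<Omega> (indicator A :: _ \<Rightarrow> real)"
      by (rule integrable_const_bound[where B = 1]) (auto simp: indicator_def)
    have "(LINT \<omega>:A|\<Omega>. indicator ?O \<omega> :: real) = (\<integral>\<omega>. indicator A \<omega> - indicator A \<omega> * indicator {\<omega>. ?S \<omega>} \<omega> \<partial>\<Omega>)"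
      unfolding set_lebesgue_integral_def
    proof (rule integral_cong_AE)
      show "AE \<omega> in \<Omega>. indicator A \<omega> *\<^sub>R indicator ?O \<omega> = indicator A \<omega> - indicator A \<omega> * (indicator {\<omega>. ?S \<omega>} \<omega> :: real)"
        using sinr_le_iff_not_success[OF j] AE_space
        by eventually_elim (auto simp: indicator_def)
    qed (use O_meas in measurable)
    also have "\<dots> = (\<integral>\<omega>. indicator A \<omega> \<partial>\<Omega>) - (\<integral>\<omega>. indicator A \<omega> * indicator {\<omega>. ?S \<omega>} \<omega> \<partial>\<Omega>)"
      by (rule Bochner_Integration.integral_diff[OF int3 int1])
    also have "\<dots> = (\<integral>\<omega>. indicator A \<omega> - indicator A \<omega> * ?s \<omega> \<partial>\<Omega>)"
      unfolding eq by (rule Bochner_Integration.integral_diff[OF int3 int2, symmetric])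
    also have "\<dots> = (LINT \<omega>:A|\<Omega>. 1 - ?s \<omega>)"
      unfolding set_lebesgue_integral_def by (simp add: algebra_simps)
    finally show "(LINT \<omega>:A|\<Omega>. indicator ?O \<omega>) = (LINT \<omega>:A|\<Omega>. 1 - ?s \<omega>)" .
  next
    show "integrable \<Omega> (indicator ?O :: _ \<Rightarrow> real)"
      by (rule integrable_real_indicator[OF O_meas]) (simp add: less_top[symmetric])
    show "integrable \<Omega> (\<lambda>\<omega>. 1 - ?s \<omega>)"
      by (rule integrable_const_bound[where B = 1]) (use success_prob_bounds in \<open>auto simp: abs_le_iff\<close>)
    \<comment> \<open>Measurability is needed with respect to the distance algebra, not merely the
      positions; it holds because the positions enter only through the distances.\<close>
    have "(\<lambda>r. success_prob (\<lambda>i. r (i, j))) \<in> borel_measurable ?N"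
      unfolding success_prob_def using j
      by (intro borel_measurable_times borel_measurable_const borel_measurable_prod
          measurable_fun_component factor_measurable) auto
    from measurable_compose[OF RF this] have "(\<lambda>\<omega>. success_prob (\<lambda>i. R \<omega> (i, j))) \<in> borel_measurable ?F" .
    moreover have "success_prob (\<lambda>i. R \<omega> (i, j)) = ?s \<omega>" for \<omega>
    proof -
      have "(\<Prod>i=1..M. factor (R \<omega> (i, j))) = (\<Prod>i=1..M. factor (norm_dist j (X i \<omega>)))"
        by (rule prod.cong) (use R_app j in simp_all)
      then show ?thesis by (simp add: success_prob_def)
    qed
    ultimately show "(\<lambda>\<omega>. 1 - ?s \<omega>) \<in> borel_measurable ?F" by simp
  qed
  then show ?thesis by (simp add: cond_outage_def)
qed

section \<open>Averages of the success factor over one interferer position\<close>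

lemma region_measure: "measure lborel (region r_out) = pi * r_out\<^sup>2"
  using r0 r_out emeasure_lborel_disk[of r_out] by (simp add: region_def measure_def)

lemma receiver_cis: "receiver r0 \<theta> j = of_real r0 * cis (if j = 1 then 0 else \<theta>)"
  by (simp add: receiver_def cis_conv_exp)

lemma expectation_position:
  fixes F :: "complex \<Rightarrow> real"
  assumes i: "i \<in> {1..M}" and F: "F \<in> borel_measurable borel"
  shows "expectation (\<lambda>\<omega>. F (X i \<omega>)) = (LINT z|uniform_measure lborel (cball 0 r_out). F z)"
proof -
  have "expectation (\<lambda>\<omega>. F (X i \<omega>)) = (LINT z|distr \<Omega> lborel (X i). F z)"
    by (subst integral_distr) (use position_meas[OF i] F in auto)
  then show ?thesis by (simp add: position_distr[OF i] region_def)
qed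

text \<open>Excludes an interferer located exactly at a receiver, the one place where
  \<open>factor\<close> and its expression by \<open>attenuation\<close> may differ.\<close>

lemma AE_uniform_norm_dist_pos:
  "AE z in uniform_measure lborel (cball 0 r_out). norm_dist j z > 0"
proof (rule AE_uniform_measureI)
  have "AE z in lborel. z \<noteq> receiver r0 \<theta> j" by (rule AE_lborel_singleton)
  then show "AE z in lborel. z \<in> cball 0 r_out \<longrightarrow> norm_dist j z > 0"
    by eventually_elim (use r0 in \<open>auto simp: norm_dist_def\<close>)
qed simp

lemma prob_space_uniform_disk: "prob_space (uniform_measure lborel (cball (0::complex) r_out))"
  using emeasure_lborel_disk[of r_out] r0 r_out by (intro prob_space_uniform_measure) auto

definition mean_attenuation :: real where
  "mean_attenuation = 2 * r0\<^sup>2 / (pi * r_out\<^sup>2) * (pi / \<beta> * Psi \<alpha> \<beta> ((r_out - r0) / r0) + calZ1 \<alpha> \<beta> r_out r0)"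

lemma mean_attenuation_eq:
  "(LINT z|uniform_measure lborel (cball 0 r_out). attenuation \<alpha> \<beta> (norm_dist j z)) = mean_attenuation"
proof -
  let ?v = "2 * r0\<^sup>2 * (pi / \<beta> * Psi \<alpha> \<beta> ((r_out - r0) / r0) + calZ1 \<alpha> \<beta> r_out r0)"
  have "(LINT z|uniform_measure lborel (cball 0 r_out). attenuation \<alpha> \<beta> (norm_dist j z)) = ?v / (pi * r_out\<^sup>2)"
  proof (rule integral_uniform_disk)
    show "(\<integral>\<^sup>+z. ennreal (attenuation \<alpha> \<beta> (norm_dist j z)) * indicator (cball 0 r_out) z \<partial>lborel) = ennreal ?v"
      unfolding norm_dist_def receiver_cis
      by (rule nn_integral_disk_attenuation[OF \<alpha> \<beta> r0 r_out])
    show "0 \<le> ?v"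
      using Psi_nonneg[OF \<beta>] calZ1_nonneg[OF \<beta> r0 r_out] \<beta> by simp
  qed (use attenuation_bounds[OF \<beta>] r0 r_out in auto)
  then show ?thesis by (simp add: mean_attenuation_def)
qed

lemma mean_attenuation_prod_eq:
  "(LINT z|uniform_measure lborel (cball 0 r_out). attenuation \<alpha> \<beta> (norm_dist 1 z) * attenuation \<alpha> \<beta> (norm_dist 2 z))
     = calX \<alpha> \<beta> r_out r0 \<theta>"
proof -
  have "(LINT z|uniform_measure lborel (cball 0 r_out). attenuation \<alpha> \<beta> (norm_dist 1 z) * attenuation \<alpha> \<beta> (norm_dist 2 z))
     = (pi * r_out\<^sup>2 * calX \<alpha> \<beta> r_out r0 \<theta>) / (pi * r_out\<^sup>2)"
  proof (rule integral_uniform_disk)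
    show "(\<integral>\<^sup>+z. ennreal (attenuation \<alpha> \<beta> (norm_dist 1 z) * attenuation \<alpha> \<beta> (norm_dist 2 z)) *
        indicator (cball 0 r_out) z \<partial>lborel) = ennreal (pi * r_out\<^sup>2 * calX \<alpha> \<beta> r_out r0 \<theta>)"
      using nn_integral_disk_attenuation_prod(1)[OF \<beta> r0 r_out] unfolding norm_dist_def receiver_cis by simp
    show "0 \<le> pi * r_out\<^sup>2 * calX \<alpha> \<beta> r_out r0 \<theta>"
      using nn_integral_disk_attenuation_prod(2)[OF \<beta> r0 r_out] by simp
  qed (use attenuation_bounds[OF \<beta>] r0 r_out in auto)
  then show ?thesis using r0 r_out by simp
qed

lemma integrable_uniform_disk:
  fixes F :: "complex \<Rightarrow> real"
  assumes "F \<in> borel_measurable borel" and "\<And>z. \<bar>F z\<bar> \<le> 1"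
  shows "integrable (uniform_measure lborel (cball (0::complex) r_out)) F"
proof -
  interpret U: prob_space "uniform_measure lborel (cball (0::complex) r_out)"
    by (rule prob_space_uniform_disk)
  show ?thesis using assms by (intro U.integrable_const_bound[where B = 1]) auto
qed

lemma expectation_factor:
  assumes i: "i \<in> {1..M}"
  shows "expectation (\<lambda>\<omega>. factor (norm_dist j (X i \<omega>))) = 1 - p + p * mean_attenuation"
proof -
  let ?u = "uniform_measure lborel (cball (0::complex) r_out)"
  interpret U: prob_space ?u by (rule prob_space_uniform_disk)
  have U1: "U.prob UNIV = 1" using U.prob_space by simp
  have "expectation (\<lambda>\<omega>. factor (norm_dist j (X i \<omega>))) = (LINT z|?u. factor (norm_dist j z))"
    by (rule expectation_position[OF i]) measurable
  also have "\<dots> = (LINT z|?u. (1 - p) + p * attenuation \<alpha> \<beta> (norm_dist j z))"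
    by (rule integral_cong_AE)
       (use AE_uniform_norm_dist_pos[of j] in \<open>auto simp: factor_eq_attenuation elim!: eventually_mono\<close>)
  also have "\<dots> = (1 - p) + p * (LINT z|?u. attenuation \<alpha> \<beta> (norm_dist j z))"
    using attenuation_bounds[OF \<beta>, of \<alpha>]
    by (subst Bochner_Integration.integral_add) (auto intro!: integrable_uniform_disk simp: U1)
  finally show ?thesis by (simp add: mean_attenuation_eq)
qed

text \<open>Expand (1 - p + p a_1)(1 - p + p a_2). The mixed terms have the same mean
  \<open>mean_attenuation\<close> for both receivers, so its constant 2 r0^2 / |A| is doubled to the
  one in \<open>calW\<close>.\<close>

lemma expectation_factor_prod:
  assumes i: "i \<in> {1..M}"
  shows "expectation (\<lambda>\<omega>. factor (norm_dist 1 (X i \<omega>)) * factor (norm_dist 2 (X i \<omega>))) = calW \<alpha> \<beta> p r_out r0 \<theta>"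
proof -
  let ?u = "uniform_measure lborel (cball (0::complex) r_out)"
  let ?a = "\<lambda>j z. attenuation \<alpha> \<beta> (norm_dist j z)"
  interpret U: prob_space ?u by (rule prob_space_uniform_disk)
  have U1: "U.prob UNIV = 1" using U.prob_space by simp
  have int: "integrable ?u (?a j)" "integrable ?u (\<lambda>z. ?a 1 z * ?a 2 z)" for j
    using attenuation_bounds[OF \<beta>, of \<alpha>]
    by (auto intro!: integrable_uniform_disk mult_le_one simp: abs_mult)
  have "expectation (\<lambda>\<omega>. factor (norm_dist 1 (X i \<omega>)) * factor (norm_dist 2 (X i \<omega>))) =
      (LINT z|?u. factor (norm_dist 1 z) * factor (norm_dist 2 z))"
    by (rule expectation_position[OF i]) measurable
  also have "\<dots> = (LINT z|?u. (1 - p)\<^sup>2 + (1 - p) * p * ?a 1 z + (1 - p) * p * ?a 2 z + p\<^sup>2 * (?a 1 z * ?a 2 z))"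
  proof (rule integral_cong_AE)
    show "AE z in ?u. factor (norm_dist 1 z) * factor (norm_dist 2 z) =
        (1 - p)\<^sup>2 + (1 - p) * p * ?a 1 z + (1 - p) * p * ?a 2 z + p\<^sup>2 * (?a 1 z * ?a 2 z)"
      using AE_uniform_norm_dist_pos[of 1] AE_uniform_norm_dist_pos[of 2]
      by eventually_elim (simp add: factor_eq_attenuation power2_eq_square algebra_simps)
  qed auto
  also have "\<dots> = (1 - p)\<^sup>2 + (1 - p) * p * mean_attenuation + (1 - p) * p * mean_attenuation + p\<^sup>2 * calX \<alpha> \<beta> r_out r0 \<theta>"
    using int by (simp add: mean_attenuation_eq mean_attenuation_prod_eq U1 del: One_nat_def)
  also have "\<dots> = calW \<alpha> \<beta> p r_out r0 \<theta>"
  proof -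
    define B where "B = pi / \<beta> * Psi \<alpha> \<beta> ((r_out - r0) / r0) + calZ1 \<alpha> \<beta> r_out r0"
    define u where "u = 2 * r0\<^sup>2 / (pi * r_out\<^sup>2)"
    have "4 * r0\<^sup>2 / (pi * r_out\<^sup>2) = 2 * u" by (simp add: u_def)
    then show ?thesis
      unfolding calW_def region_measure mean_attenuation_def B_def[symmetric] u_def[symmetric]
      by (simp add: algebra_simps)
  qed
  finally show ?thesis .
qed

section \<open>Independence across interferers and the joint moment\<close>

lemma expectation_prod_positions:
  fixes F :: "complex \<Rightarrow> real"
  assumes F: "F \<in> borel_measurable borel" and bd: "\<And>z. \<bar>F z\<bar> \<le> 1"
  shows "expectation (\<lambda>\<omega>. \<Prod>i=1..M. F (X i \<omega>)) = (\<Prod>i=1..M. expectation (\<lambda>\<omega>. F (X i \<omega>)))"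
proof (rule indep_vars_lebesgue_integral)
  have "indep_vars (\<lambda>i. PiM {Position i} (\<lambda>_. borel)) (\<lambda>i \<omega>. restrict (\<lambda>s. source_var s \<omega>) {Position i}) {1..M}"
    by (rule indep_vars_restrict[OF indep_source_var]) (auto simp: sources_def disjoint_family_on_def)
  then have "indep_vars (\<lambda>_. borel) (\<lambda>i \<omega>. (\<lambda>i q. F (q (Position i))) i (restrict (\<lambda>s. source_var s \<omega>) {Position i})) {1..M}"
    by (rule indep_vars_compose2) (auto intro!: measurable_fun_component F)
  then show "indep_vars (\<lambda>_. borel) (\<lambda>i \<omega>. F (X i \<omega>)) {1..M}" by simp
  show "integrable \<Omega> (\<lambda>\<omega>. F (X i \<omega>))" if "i \<in> {1..M}" for i
    using bd position_fun_measurable[OF F that] by (intro integrable_const_bound[where B = 1]) auto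
qed simp

text \<open>The right-hand side does not involve j: this is the rotational symmetry that allows
  either receiver in the final formula.\<close>

lemma expectation_success:
  "expectation (\<lambda>\<omega>. success_prob (\<lambda>i. norm_dist j (X i \<omega>))) = exp (- \<beta> / SNR) * (1 - p + p * mean_attenuation) ^ M"
proof -
  have "expectation (\<lambda>\<omega>. \<Prod>i=1..M. factor (norm_dist j (X i \<omega>))) = (1 - p + p * mean_attenuation) ^ M"
    by (subst expectation_prod_positions[of "\<lambda>z. factor (norm_dist j z)"])
       (use factor_bounds in \<open>auto simp: expectation_factor\<close>)
  then show ?thesis unfolding success_prob_def by simp
qed

text \<open>The factors of one interferer at the two receivers share a position and need not be
  independent. They are therefore multiplied first, and independence is used only across
  interferers.\<close>

lemma expectation_success_joint:
  "expectation (\<lambda>\<omega>. success_prob (\<lambda>i. norm_dist 1 (X i \<omega>)) * success_prob (\<lambda>i. norm_dist 2 (X i \<omega>))) =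
     exp (- 2 * \<beta> / SNR) * calW \<alpha> \<beta> p r_out r0 \<theta> ^ M"
proof -
  have "success_prob (\<lambda>i. norm_dist 1 (X i \<omega>)) * success_prob (\<lambda>i. norm_dist 2 (X i \<omega>)) =
     exp (- 2 * \<beta> / SNR) * (\<Prod>i=1..M. factor (norm_dist 1 (X i \<omega>)) * factor (norm_dist 2 (X i \<omega>)))" for \<omega>
    unfolding success_prob_def by (simp add: prod.distrib mult_exp_exp mult_ac)
  moreover have "expectation (\<lambda>\<omega>. \<Prod>i=1..M. factor (norm_dist 1 (X i \<omega>)) * factor (norm_dist 2 (X i \<omega>)))
      = calW \<alpha> \<beta> p r_out r0 \<theta> ^ M"
    by (subst expectation_prod_positions[of "\<lambda>z. factor (norm_dist 1 z) * factor (norm_dist 2 z)"])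
       (use factor_bounds expectation_factor_prod in \<open>auto simp: abs_mult intro!: mult_le_one\<close>)
  ultimately show ?thesis by simp
qed

lemma joint_moment:
  assumes j: "j \<in> {1, 2}"
  shows "expectation (\<lambda>\<omega>. cond_outage \<Omega> \<alpha> \<beta> SNR r0 \<theta> M g I X 1 \<omega> * cond_outage \<Omega> \<alpha> \<beta> SNR r0 \<theta> M g I X 2 \<omega>)
    = 2 * expectation (cond_outage \<Omega> \<alpha> \<beta> SNR r0 \<theta> M g I X j) - 1 + exp (- 2 * \<beta> / SNR) * calW \<alpha> \<beta> p r_out r0 \<theta> ^ M"
proof -
  let ?s = "\<lambda>j \<omega>. success_prob (\<lambda>i. norm_dist j (X i \<omega>))"
  let ?e = "\<lambda>j. cond_outage \<Omega> \<alpha> \<beta> SNR r0 \<theta> M g I X j"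
  have em[measurable]: "?e j \<in> borel_measurable \<Omega>" for j
    unfolding cond_outage_def by simp
  have sm[measurable]: "?s j \<in> borel_measurable \<Omega>" for j by (rule success_prob_measurable)
  have int: "integrable \<Omega> (?s j)" for j
    by (rule integrable_const_bound[where B = 1]) (use success_prob_bounds in auto)
  have int12: "integrable \<Omega> (\<lambda>\<omega>. ?s 1 \<omega> * ?s 2 \<omega>)"
    by (rule integrable_const_bound[where B = 1]) (use success_prob_bounds in \<open>auto simp: abs_mult intro!: mult_le_one\<close>)
  have "expectation (\<lambda>\<omega>. ?e 1 \<omega> * ?e 2 \<omega>) = expectation (\<lambda>\<omega>. 1 - ?s 1 \<omega> - ?s 2 \<omega> + ?s 1 \<omega> * ?s 2 \<omega>)"
  proof (rule integral_cong_AE)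
    show "AE \<omega> in \<Omega>. ?e 1 \<omega> * ?e 2 \<omega> = 1 - ?s 1 \<omega> - ?s 2 \<omega> + ?s 1 \<omega> * ?s 2 \<omega>"
    proof -
      have "AE \<omega> in \<Omega>. ?e 1 \<omega> = 1 - ?s 1 \<omega>" "AE \<omega> in \<Omega>. ?e 2 \<omega> = 1 - ?s 2 \<omega>"
        by (rule cond_outage_eq; simp)+
      then show ?thesis
      proof eventually_elim
        case (elim \<omega>)
        show ?case unfolding elim by (simp add: algebra_simps)
      qed
    qed
  qed auto
  also have "\<dots> = 1 - expectation (?s 1) - expectation (?s 2) + expectation (\<lambda>\<omega>. ?s 1 \<omega> * ?s 2 \<omega>)"
    using int int12 by (simp add: prob_space)
  \<comment> \<open>Both single means are replaced by the one for the given j, which is possible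
    because the mean is the same at either receiver.\<close>
  also have "\<dots> = 1 - 2 * expectation (?s j) + exp (- 2 * \<beta> / SNR) * calW \<alpha> \<beta> p r_out r0 \<theta> ^ M"
    by (simp only: expectation_success expectation_success_joint)
  also have "expectation (?s j) = 1 - expectation (?e j)"
  proof -
    have "expectation (?e j) = expectation (\<lambda>\<omega>. 1 - ?s j \<omega>)"
      by (rule integral_cong_AE) (use cond_outage_eq[OF j] in auto)
    also have "\<dots> = 1 - expectation (?s j)" using int by (simp add: prob_space)
    finally show ?thesis by simp
  qed
  finally show ?thesis by simp
qed

end

theorem theorem3:
  fixes \<Omega> :: "'w measure"
    and M :: nat
    and g :: "nat \<Rightarrow> nat \<Rightarrow> 'w \<Rightarrow> real"
    and I :: "nat \<Rightarrow> 'w \<Rightarrow> bool"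
    and X :: "nat \<Rightarrow> 'w \<Rightarrow> complex"
    and \<alpha> \<beta> SNR p r_out r0 \<theta> :: real
  assumes "prob_space \<Omega>"
    and "\<alpha> > 0" and "\<beta> > 0" and "SNR > 0"
    and "0 \<le> p" and "p \<le> 1"
    and "0 < r0" and "r0 \<le> r_out"
    and fading: "\<And>i j. i \<in> {0..M} \<Longrightarrow> j \<in> {1, 2} \<Longrightarrow>
           distributed \<Omega> lborel (g i j) (exponential_density 1)"
    and access_meas: "\<And>i. i \<in> {1..M} \<Longrightarrow> I i \<in> measurable \<Omega> (count_space UNIV)"
    and access_distr: "\<And>i. i \<in> {1..M} \<Longrightarrow>
           distr \<Omega> (count_space UNIV) (I i) = measure_pmf (bernoulli_pmf p)"
    and position_meas: "\<And>i. i \<in> {1..M} \<Longrightarrow> X i \<in> borel_measurable \<Omega>"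
    and position_distr: "\<And>i. i \<in> {1..M} \<Longrightarrow>
           distr \<Omega> lborel (X i) = uniform_measure lborel (region r_out)"
    and indep: "prob_space.indep_sets \<Omega> (source_events \<Omega> g I X) (sources M)"
  shows "(\<forall>j\<in>{1, 2}.
           prob_space.expectation \<Omega>
             (\<lambda>\<omega>. cond_outage \<Omega> \<alpha> \<beta> SNR r0 \<theta> M g I X 1 \<omega> *
                  cond_outage \<Omega> \<alpha> \<beta> SNR r0 \<theta> M g I X 2 \<omega>)
           = 2 * prob_space.expectation \<Omega> (cond_outage \<Omega> \<alpha> \<beta> SNR r0 \<theta> M g I X j) - 1
             + exp (- 2 * \<beta> / SNR) * calW \<alpha> \<beta> p r_out r0 \<theta> ^ M) \<and>
         (\<forall>x\<ge>0. complex_of_real (Psi \<alpha> \<beta> x) =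
           of_real (x powr (\<alpha> + 2) / (2 + \<alpha>)) *
           gauss_2F1 1 (of_real (2 / \<alpha> + 1)) (of_real (2 / \<alpha> + 2)) (of_real (- (x powr \<alpha> / \<beta>))))"
proof -
  interpret interference_network \<Omega> M g I X \<alpha> \<beta> SNR p r_out r0 \<theta>
    using assms by (intro interference_network.intro interference_network_axioms.intro)
  show ?thesis
    using joint_moment Psi_eq_gauss_2F1[OF \<alpha> \<beta>] by blast
qed

end
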